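(* Let $I$ be an index set of non-measurable cardinality and let $H$ be the group $\mathbb Z^{(I)}$ equipped with the topology of pointwise convergence on $\mathbb Z^I$ (via the pairing $\langle \bar g,\bar x\rangle=\sum_{i\in I}\bar g(i)\bar x(i)$). Then $\widehat H\cong\mathbb Z^I\otimes_{\mathcal Q}\mathbb T$.
   Context: $\mathbb Z^{(I)}$ is the direct sum of $I$ copies of $\mathbb Z$ (finitely supported functions $I\to\mathbb Z$), which is identified with $\operatorname{Hom}(\mathbb Z^I,\mathbb Z)$ through the pairing above; the topology on $H$ is the weakest making every map $\bar g\mapsto\langle\bar g,\bar x\rangle\in\mathbb Z$ ($\bar x\in\mathbb Z^I$, $\mathbb Z$ discrete) continuous. $\mathbb Z^I$ has the product topology. $\mathbb T=\mathbb R/\mathbb Z$; $\widehat H$ is the group of continuous homomorphisms $H\to\mathbb T$ with the compact-open topology. A subset $A$ of a topological abelian group $L$ is quasi-convex if for every $g\notin A$ there is a continuous character $\chi$ with $|\chi(a)|\le1/4$ on $A$ and $|\chi(g)|>1/4$; $\mathcal Q$ is the class of Hausdorff abelian groups with a basis at $0$ of quasi-convex sets. A continuous bihomomorphism $b:G_1\times G_2\to L$ is separately a continuous homomorphism in each variable and continuous at $(0,0)$. For $G_1,G_2\in\mathcal Q$, $G_1\otimes_{\mathcal Q}G_2$ is the group in $\mathcal Q$ with a continuous bihomomorphism $\otimes_{\mathcal Q}:G_1\times G_2\to G_1\otimes_{\mathcal Q}G_2$ through which every continuous bihomomorphism into a group of $\mathcal Q$ factors via a unique continuous homomorphism (unique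 up to topological isomorphism). *)

theory Defs
  imports "HOL-Analysis.Analysis"
begin

record 'g tgroup =
  tg_carrier :: "'g set"
  tg_add :: "'g \<Rightarrow> 'g \<Rightarrow> 'g"
  tg_zero :: "'g"
  tg_neg :: "'g \<Rightarrow> 'g"
  tg_top :: "'g topology"

definition top_ab_group :: "'g tgroup \<Rightarrow> bool" where
  "top_ab_group G \<longleftrightarrow>
     topspace (tg_top G) = tg_carrier G \<and>
     tg_zero G \<in> tg_carrier G \<and>
     (\<forall>x\<in>tg_carrier G. \<forall>y\<in>tg_carrier G. tg_add G x y \<in> tg_carrier G) \<and>
     (\<forall>x\<in>tg_carrier G. tg_neg G x \<in> tg_carrier G) \<and>
     (\<forall>x\<in>tg_carrier G. \<forall>y\<in>tg_carrier G. \<forall>z\<in>tg_carrier G.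
        tg_add G (tg_add G x y) z = tg_add G x (tg_add G y z)) \<and>
     (\<forall>x\<in>tg_carrier G. \<forall>y\<in>tg_carrier G. tg_add G x y = tg_add G y x) \<and>
     (\<forall>x\<in>tg_carrier G. tg_add G x (tg_zero G) = x) \<and>
     (\<forall>x\<in>tg_carrier G. tg_add G x (tg_neg G x) = tg_zero G) \<and>
     continuous_map (prod_topology (tg_top G) (tg_top G)) (tg_top G)
        (\<lambda>(x, y). tg_add G x y) \<and>
     continuous_map (tg_top G) (tg_top G) (tg_neg G)"

definition cont_hom :: "'g tgroup \<Rightarrow> 'h tgroup \<Rightarrow> ('g \<Rightarrow> 'h) \<Rightarrow> bool" where
  "cont_hom G L f \<longleftrightarrow>
     (\<forall>x\<in>tg_carrier G. f x \<in> tg_carrier L) \<and>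
     (\<forall>x\<in>tg_carrier G. \<forall>y\<in>tg_carrier G. f (tg_add G x y) = tg_add L (f x) (f y)) \<and>
     continuous_map (tg_top G) (tg_top L) f"

definition TT :: "real tgroup" where
  "TT = \<lparr> tg_carrier = {0..<1},
          tg_add = (\<lambda>x y. frac (x + y)),
          tg_zero = 0,
          tg_neg = (\<lambda>x. frac (- x)),
          tg_top = topology (\<lambda>U. U \<subseteq> {0..<1} \<and> open {r::real. frac r \<in> U}) \<rparr>"

text \<open>The "absolute value" |t| in T = R/Z, i.e. distance of t to 0 (for t in [0,1)).\<close>
definition tnorm :: "real \<Rightarrow> real" where
  "tnorm t = min (frac t) (1 - frac t)"

definition character :: "'g tgroup \<Rightarrow> ('g \<Rightarrow> real) \<Rightarrow> bool" where
  "character G ch \<longleftrightarrow> cont_hom G TT ch"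

definition quasi_convex :: "'g tgroup \<Rightarrow> 'g set \<Rightarrow> bool" where
  "quasi_convex G A \<longleftrightarrow> A \<subseteq> tg_carrier G \<and>
     (\<forall>g\<in>tg_carrier G - A. \<exists>ch. character G ch \<and>
        (\<forall>a\<in>A. tnorm (ch a) \<le> 1/4) \<and> tnorm (ch g) > 1/4)"

definition in_Q :: "'g tgroup \<Rightarrow> bool" where
  "in_Q G \<longleftrightarrow> top_ab_group G \<and> Hausdorff_space (tg_top G) \<and>
     (\<forall>U. openin (tg_top G) U \<and> tg_zero G \<in> U \<longrightarrow>
        (\<exists>V W. quasi_convex G V \<and> openin (tg_top G) W \<and> tg_zero G \<in> W \<and> W \<subseteq> V \<and> V \<subseteq> U))"

definition cont_bihom :: "'g tgroup \<Rightarrow> 'h tgroup \<Rightarrow> 'l tgroup \<Rightarrow> ('g \<Rightarrow> 'h \<Rightarrow> 'l) \<Rightarrow> bool" where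
  "cont_bihom G1 G2 L b \<longleftrightarrow>
     (\<forall>x\<in>tg_carrier G1. cont_hom G2 L (b x)) \<and>
     (\<forall>y\<in>tg_carrier G2. cont_hom G1 L (\<lambda>x. b x y)) \<and>
     (\<forall>W. openin (tg_top L) W \<and> tg_zero L \<in> W \<longrightarrow>
        (\<exists>U V. openin (tg_top G1) U \<and> tg_zero G1 \<in> U \<and>
               openin (tg_top G2) V \<and> tg_zero G2 \<in> V \<and>
               (\<forall>x\<in>U. \<forall>y\<in>V. b x y \<in> W)))"

text \<open>\<open>is_Q_tensor TYPE('l) G1 G2 T t\<close>: the group T together with the continuous bihomomorphism t
  is a tensor product of G1 and G2 in the class Q, where the universal property is required
  for all target groups L in Q whose elements live in the type 'l.\<close>
definition is_Q_tensor ::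
  "'l itself \<Rightarrow> 'g tgroup \<Rightarrow> 'h tgroup \<Rightarrow> 'k tgroup \<Rightarrow> ('g \<Rightarrow> 'h \<Rightarrow> 'k) \<Rightarrow> bool" where
  "is_Q_tensor (_ :: 'l itself) G1 G2 T t \<longleftrightarrow>
     in_Q G1 \<and> in_Q G2 \<and> in_Q T \<and> cont_bihom G1 G2 T t \<and>
     (\<forall>(L :: 'l tgroup) c. in_Q L \<and> cont_bihom G1 G2 L c \<longrightarrow>
        (\<exists>\<phi>. cont_hom T L \<phi> \<and>
             (\<forall>x\<in>tg_carrier G1. \<forall>y\<in>tg_carrier G2. c x y = \<phi> (t x y)) \<and>
             (\<forall>\<psi>. cont_hom T L \<psi> \<and>
                  (\<forall>x\<in>tg_carrier G1. \<forall>y\<in>tg_carrier G2. c x y = \<psi> (t x y)) \<longrightarrow>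
                  (\<forall>z\<in>tg_carrier T. \<psi> z = \<phi> z))))"

definition ZI :: "'a set \<Rightarrow> ('a \<Rightarrow> int) tgroup" where
  "ZI I = \<lparr> tg_carrier = (\<Pi>\<^sub>E i\<in>I. UNIV),
            tg_add = (\<lambda>x y. \<lambda>i\<in>I. x i + y i),
            tg_zero = (\<lambda>i\<in>I. 0),
            tg_neg = (\<lambda>x. \<lambda>i\<in>I. - x i),
            tg_top = product_topology (\<lambda>_. (euclidean :: int topology)) I \<rparr>"

definition fin_supp :: "'a set \<Rightarrow> ('a \<Rightarrow> int) set" where
  "fin_supp I = {g. finite {i. g i \<noteq> 0} \<and> (\<forall>i. i \<notin> I \<longrightarrow> g i = 0)}"

definition pairing :: "('a \<Rightarrow> int) \<Rightarrow> ('a \<Rightarrow> int) \<Rightarrow> int" where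
  "pairing g x = (\<Sum>i\<in>{i. g i \<noteq> 0}. g i * x i)"

text \<open>H = Z^(I) with the weakest topology making all g |-> <g,x> (x in Z^I) continuous into discrete Z.\<close>
definition HI :: "'a set \<Rightarrow> ('a \<Rightarrow> int) tgroup" where
  "HI I = \<lparr> tg_carrier = fin_supp I,
            tg_add = (\<lambda>g h. \<lambda>i. g i + h i),
            tg_zero = (\<lambda>i. 0),
            tg_neg = (\<lambda>g. \<lambda>i. - g i),
            tg_top = topology_generated_by
               {{g \<in> fin_supp I. pairing g x \<in> U} | x U. x \<in> (\<Pi>\<^sub>E i\<in>I. UNIV)} \<rparr>"

definition dual :: "'g tgroup \<Rightarrow> ('g \<Rightarrow> real) tgroup" where
  "dual G = \<lparr> tg_carrier = {ch. character G ch \<and> ch \<in> extensional (tg_carrier G)},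
              tg_add = (\<lambda>ch \<psi>. \<lambda>g\<in>tg_carrier G. frac (ch g + \<psi> g)),
              tg_zero = (\<lambda>g\<in>tg_carrier G. 0),
              tg_neg = (\<lambda>ch. \<lambda>g\<in>tg_carrier G. frac (- ch g)),
              tg_top = topology_generated_by
                {{ch. character G ch \<and> ch \<in> extensional (tg_carrier G) \<and> ch ` K \<subseteq> U} | K U.
                   compactin (tg_top G) K \<and> openin (tg_top TT) U} \<rparr>"

definition canon_bihom :: "'a set \<Rightarrow> ('a \<Rightarrow> int) \<Rightarrow> real \<Rightarrow> (('a \<Rightarrow> int) \<Rightarrow> real)" where
  "canon_bihom I x t = (\<lambda>g\<in>fin_supp I. frac (t * real_of_int (pairing g x)))"

definition countably_complete_ultrafilter :: "'a set \<Rightarrow> 'a set set \<Rightarrow> bool" where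
  "countably_complete_ultrafilter I F \<longleftrightarrow>
     F \<subseteq> Pow I \<and> I \<in> F \<and> {} \<notin> F \<and>
     (\<forall>A B. A \<in> F \<and> A \<subseteq> B \<and> B \<subseteq> I \<longrightarrow> B \<in> F) \<and>
     (\<forall>C. C \<subseteq> F \<and> C \<noteq> {} \<and> countable C \<longrightarrow> \<Inter>C \<in> F) \<and>
     (\<forall>A. A \<subseteq> I \<longrightarrow> A \<in> F \<or> I - A \<in> F)"

definition nonmeasurable_card :: "'a set \<Rightarrow> bool" where
  "nonmeasurable_card I \<longleftrightarrow>
     (\<forall>F. countably_complete_ultrafilter I F \<longrightarrow> (\<exists>i\<in>I. F = {A. A \<subseteq> I \<and> i \<in> A}))"

end

theory Submission
  imports Defs
begin

text \<open>A subset of \<open>H\<close> on which every pairing takes finitely many values is finite (gliding hump),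
  so the compact-open topology on the dual of \<open>H\<close> is pointwise convergence; and since \<open>H\<close> has a
  neighbourhood basis of subgroups, its characters are the finite sums of maps
  \<open>g \<mapsto> t \<cdot> \<langle>g, x\<rangle>\<close>. Given a continuous bihomomorphism \<open>c\<close> into a group \<open>L\<close> of the class Q,
  each character \<open>ch\<close> of \<open>L\<close> yields a continuous bihomomorphism \<open>ch \<circ> c\<close> into the circle, which
  has the form \<open>(x, t) \<mapsto> t \<cdot> \<langle>g, x\<rangle>\<close> for a finitely supported \<open>g\<close>. The
  factorization sends \<open>z\<close> to the unique \<open>l\<close> with \<open>ch l = z g\<close> for all \<open>ch\<close>. It is continuous
  because the characters in the polar of a neighbourhood of zero give only finitely many \<open>g\<close>:
  their supports lie in a common finite set and their values are uniformly bounded.\<close>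

section \<open>The distance to zero in the circle\<close>

text \<open>The finite support of \<open>g\<close> is a consequence of joint continuity at the
  origin. Basic neighbourhoods of zero in Z^I are subgroups, so a bound on \<open>ch (c x t)\<close>
  for all \<open>x\<close> in such a subgroup and all small \<open>t\<close> holds for every
  multiple of \<open>x\<close> as well. The arc of radius 1/4 contains no nontrivial subgroup of the
  circle, so the integer by which \<open>t\<close> gets multiplied vanishes on that subgroup and
  depends on finitely many coordinates only. The same property of 1/4 makes a character of H trivial
  on an open subgroup.

  The obstacle in the factorization is that an element of the dual has many expressions as a sum of
  canonical ones, so a value obtained by summing terms \<open>c x t\<close> might depend on the
  expression. Characters of L separate points and see such a sum only through \<open>z\<close>,
  which removes the ambiguity. Continuity meets a second gap: neighbourhoods in L are cut out by
  possibly infinitely many characters, while those in the dual of H restrict only finitely many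
  evaluations.\<close>

lemma tnorm_le: "n \<in> \<int> \<Longrightarrow> tnorm x \<le> \<bar>x - n\<bar>"
proof -
  assume "n \<in> \<int>"
  then obtain k where k: "n = of_int k" by (auto elim: Ints_cases)
  have f: "x = of_int \<lfloor>x\<rfloor> + frac x" by (simp add: frac_def)
  have b: "0 \<le> frac x" "frac x < 1" by (auto simp: frac_lt_1)
  consider "k \<le> \<lfloor>x\<rfloor>" | "k \<ge> \<lfloor>x\<rfloor> + 1" by linarith
  then show ?thesis
  proof cases
    case 1
    then have "real_of_int k \<le> of_int \<lfloor>x\<rfloor>" by simp
    then show ?thesis using f b k unfolding tnorm_def by linarith
  next
    case 2
    then have "real_of_int k \<ge> of_int \<lfloor>x\<rfloor> + 1" by linarith
    then show ?thesis using f b k unfolding tnorm_def by linarith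
  qed
qed

text \<open>With \<open>tnorm_le\<close> this identifies \<open>tnorm\<close> as the distance to the
  nearest integer on all of the reals. Later estimates choose a nearest integer and work with an
  ordinary absolute value.\<close>

lemma tnorm_attained: "\<exists>n\<in>\<int>. tnorm x = \<bar>x - n\<bar>"
proof -
  have b: "0 \<le> frac x" "frac x < 1" by (auto simp: frac_lt_1)
  have "tnorm x = \<bar>x - of_int \<lfloor>x\<rfloor>\<bar> \<or> tnorm x = \<bar>x - of_int (\<lfloor>x\<rfloor> + 1)\<bar>"
    using b by (simp add: tnorm_def frac_def) linarith
  then show ?thesis by (metis Ints_of_int)
qed

lemma tnorm_ge_0: "0 \<le> tnorm x"
  using tnorm_attained[of x] by auto

lemma tnorm_le_abs: "tnorm x \<le> \<bar>x\<bar>"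
  using tnorm_le[of 0 x] by simp

lemma tnorm_cong: assumes "x - y \<in> \<int>" shows "tnorm x = tnorm y"
proof -
  have le: "tnorm u \<le> tnorm v" if uv: "u - v \<in> \<int>" for u v
  proof -
    obtain n where n: "n \<in> \<int>" "tnorm v = \<bar>v - n\<bar>" using tnorm_attained by blast
    have "tnorm u \<le> \<bar>u - (n + (u - v))\<bar>" using n uv by (intro tnorm_le) auto
    then show ?thesis using n by simp
  qed
  have "y - x \<in> \<int>" using assms by (metis Ints_minus minus_diff_eq)
  then show ?thesis using le assms by (intro antisym) auto
qed

lemma frac_diff_Ints: "frac x - x \<in> \<int>" "x - frac x \<in> \<int>"
  by (auto simp: frac_def)

lemma frac_eq_iff: "frac x = frac y \<longleftrightarrow> x - y \<in> \<int>" for x y :: real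
proof
  assume "frac x = frac y"
  then show "x - y \<in> \<int>" unfolding frac_def
    by (metis Ints_diff Ints_of_int add_diff_cancel_left diff_add_cancel diff_diff_eq2)
next
  assume "x - y \<in> \<int>"
  then obtain k where "x = y + of_int k" by (metis Ints_cases add.commute diff_add_cancel)
  then show "frac x = frac y" by (simp add: frac_def)
qed

lemma tnorm_minus [simp]: "tnorm (- x) = tnorm x"
proof -
  have le: "tnorm (- u) \<le> tnorm u" for u
  proof -
    obtain n where n: "n \<in> \<int>" "tnorm u = \<bar>u - n\<bar>" using tnorm_attained by blast
    then show ?thesis using tnorm_le[of "- n" "- u"] by simp
  qed
  show ?thesis using le[of x] le[of "- x"] by simp
qed

lemma tnorm_triangle: "tnorm (x + y) \<le> tnorm x + tnorm y"
proof -
  obtain n where n: "n \<in> \<int>" "tnorm x = \<bar>x - n\<bar>" using tnorm_attained by blast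
  obtain m where m: "m \<in> \<int>" "tnorm y = \<bar>y - m\<bar>" using tnorm_attained by blast
  have "tnorm (x + y) \<le> \<bar>x + y - (n + m)\<bar>" using n m by (intro tnorm_le) auto
  then show ?thesis using n m by linarith
qed

lemma tnorm_eq_0: "tnorm x = 0 \<longleftrightarrow> x \<in> \<int>"
proof
  assume "tnorm x = 0" then show "x \<in> \<int>" using tnorm_attained[of x] by auto
next
  assume "x \<in> \<int>" then show "tnorm x = 0" using tnorm_le[of x x] tnorm_ge_0[of x] by simp
qed

lemma tnorm_zero [simp]: "tnorm 0 = 0"
  by (simp add: tnorm_eq_0)

lemma tnorm_frac [simp]: "tnorm (frac x) = tnorm x"
  by (rule tnorm_cong) (simp add: frac_diff_Ints)

lemma tnorm_multiple: "tnorm (real k * x) \<le> real k * tnorm x"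
proof (induction k)
  case (Suc k)
  have "tnorm (real (Suc k) * x) \<le> tnorm (real k * x) + tnorm x"
    using tnorm_triangle[of "real k * x" x] by (simp add: algebra_simps)
  then show ?case using Suc by (simp add: algebra_simps)
qed (simp add: tnorm_def)

lemma tnorm_eq_abs: "\<bar>x\<bar> \<le> 1/2 \<Longrightarrow> tnorm x = \<bar>x\<bar>"
proof -
  assume a: "\<bar>x\<bar> \<le> 1/2"
  obtain n where n: "n \<in> \<int>" "tnorm x = \<bar>x - n\<bar>" using tnorm_attained by blast
  obtain k where k: "n = of_int k" using n by (auto elim: Ints_cases)
  have "\<bar>x - n\<bar> \<ge> \<bar>x\<bar>"
  proof (cases "k = 0")
    case False
    then have "\<bar>n\<bar> \<ge> 1" using k by linarith
    then show ?thesis using a by linarith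
  qed (simp add: k)
  then show ?thesis using n tnorm_le_abs[of x] by linarith
qed

text \<open>The bound for \<open>n\<close> keeps the multiple by \<open>n + 1\<close> of the reduced
  number within 1/2, where \<open>tnorm\<close> is the absolute value; there the hypothesis on that
  multiple can be divided by \<open>n + 1\<close>.\<close>

lemma tnorm_small_multiples:
  assumes "1 \<le> n" and "\<And>k. 1 \<le> k \<Longrightarrow> k \<le> n \<Longrightarrow> tnorm (real k * x) \<le> 1/4"
  shows "tnorm x \<le> 1 / (4 * real n)"
  using assms
proof (induction n rule: nat_induct_at_least)
  case base
  then show ?case using base[of 1] by simp
next
  case (Suc n)
  obtain m where m: "m \<in> \<int>" "tnorm x = \<bar>x - m\<bar>" using tnorm_attained by blast
  define y where "y = real (Suc n) * (x - m)"
  have "tnorm x \<le> 1 / (4 * real n)" using Suc by auto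
  then have "real (Suc n) * \<bar>x - m\<bar> \<le> real (Suc n) * (1 / (4 * real n))"
    using m by (intro mult_left_mono) auto
  \<comment> \<open>(n + 1) / (4 n) is at most 1/2 precisely because n is at least 1.\<close>
  also have "\<dots> \<le> 1/2" using Suc.hyps by (simp add: field_simps)
  finally have "tnorm y = \<bar>y\<bar>" by (intro tnorm_eq_abs) (simp add: y_def abs_mult)
  moreover have "tnorm y = tnorm (real (Suc n) * x)"
    using m by (intro tnorm_cong) (auto simp: y_def algebra_simps intro!: Ints_add Ints_mult Ints_minus)
  moreover have "tnorm (real (Suc n) * x) \<le> 1/4" using Suc.prems[of "Suc n"] by simp
  ultimately have "real (Suc n) * \<bar>x - m\<bar> \<le> 1/4" by (simp add: y_def abs_mult)
  then show ?case using m by (simp add: field_simps)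
qed

text \<open>The closed arc of radius 1/4 contains no nontrivial subgroup of the circle. This is the
  source of every rigidity argument below.\<close>

lemma tnorm_bounded_multiples:
  assumes "\<And>k::nat. tnorm (real k * x) \<le> 1/4"
  shows "x \<in> \<int>"
proof -
  have "tnorm x \<le> 0"
  proof (rule field_le_epsilon)
    fix e :: real assume "e > 0"
    then obtain n :: nat where n: "n > 0" "1 / real n < e"
      using nat_approx_posE by (metis of_nat_Suc zero_less_Suc)
    have "tnorm x \<le> 1 / (4 * real n)" using n assms by (intro tnorm_small_multiples) auto
    also have "\<dots> \<le> 1 / real n" using n by (simp add: field_simps)
    finally show "tnorm x \<le> 0 + e" using n by simp
  qed
  then show ?thesis using tnorm_ge_0[of x] tnorm_eq_0[of x] by linarith
qed

interpretation circle: Metric_space "{0..<1}" "\<lambda>x y. tnorm (x - y)"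
proof
  fix x y z :: real
  show "0 \<le> tnorm (x - y)" by (rule tnorm_ge_0)
  show "tnorm (x - y) = tnorm (y - x)" using tnorm_minus[of "x - y"] by simp
  assume xy: "x \<in> {0..<1}" "y \<in> {0..<1}"
  show "(tnorm (x - y) = 0) = (x = y)"
    using xy frac_eq_iff[of x y] by (simp add: tnorm_eq_0 frac_eq_id)
  show "tnorm (x - z) \<le> tnorm (x - y) + tnorm (y - z)"
    using tnorm_triangle[of "x - y" "y - z"] by simp
qed

lemma tnorm_frac_diff: "tnorm (frac x - frac y) = tnorm (x - y)"
  by (rule tnorm_cong) (simp add: frac_def)

lemma open_frac_preimage_iff:
  assumes "U \<subseteq> {0..<1}"
  shows "open {r. frac r \<in> U} \<longleftrightarrow> (\<forall>x\<in>U. \<exists>e>0. circle.mball x e \<subseteq> U)"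
proof
  assume o: "open {r. frac r \<in> U}"
  show "\<forall>x\<in>U. \<exists>e>0. circle.mball x e \<subseteq> U"
  proof
    fix x assume x: "x \<in> U"
    then have "x \<in> {r. frac r \<in> U}" using assms frac_eq_id by auto
    then obtain e where e: "e > 0" "\<And>y. \<bar>y - x\<bar> < e \<Longrightarrow> frac y \<in> U"
      using o unfolding open_dist dist_real_def by blast
    have "circle.mball x e \<subseteq> U"
    proof
      fix y assume "y \<in> circle.mball x e"
      then have y: "y \<in> {0..<1}" "tnorm (y - x) < e" by (simp_all add: circle.commute)
      \<comment> \<open>A ball in the circle can wrap around at 0, so \<open>y\<close> need not be
        close to \<open>x\<close> as a real number; its translate \<open>y - n\<close> is.\<close>
      obtain n where n: "n \<in> \<int>" "tnorm (y - x) = \<bar>y - x - n\<bar>" using tnorm_attained by blast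
      then have "frac (y - n) \<in> U" using y by (intro e) (simp add: algebra_simps)
      moreover have "frac (y - n) = frac y" using n by (simp add: frac_eq_iff)
      ultimately show "y \<in> U" using y frac_eq_id by simp
    qed
    then show "\<exists>e>0. circle.mball x e \<subseteq> U" using e by blast
  qed
next
  assume b: "\<forall>x\<in>U. \<exists>e>0. circle.mball x e \<subseteq> U"
  show "open {r. frac r \<in> U}"
    unfolding open_dist
  proof
    fix r assume "r \<in> {r. frac r \<in> U}"
    then obtain e where e: "e > 0" "circle.mball (frac r) e \<subseteq> U" using b by blast
    have "frac y \<in> U" if "\<bar>y - r\<bar> < e" for y
    proof -
      have "tnorm (r - y) \<le> \<bar>y - r\<bar>" using tnorm_le_abs[of "r - y"] by simp
      then have "frac y \<in> circle.mball (frac r) e"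
        using that by (simp add: tnorm_frac_diff frac_lt_1)
      then show ?thesis using e by blast
    qed
    then show "\<exists>e>0. \<forall>y. dist y r < e \<longrightarrow> y \<in> {r. frac r \<in> U}"
      using e by (auto simp: dist_real_def)
  qed
qed

lemma TT_sel [simp]:
  "tg_carrier TT = {0..<1}" "tg_add TT x y = frac (x + y)" "tg_zero TT = 0" "tg_neg TT x = frac (- x)"
  by (simp_all add: TT_def)

text \<open>Agreement of the defining predicate with the open sets of a metric also settles that it
  is a topology, without which \<open>topology\<close> would say nothing about it.\<close>

lemma top_TT: "tg_top TT = circle.mtopology"
proof -
  have "(\<lambda>U. U \<subseteq> {0..<1} \<and> open {r::real. frac r \<in> U}) = openin circle.mtopology"
    by (rule ext) (metis circle.openin_mtopology open_frac_preimage_iff circle.mtopology_def)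
  then show ?thesis by (simp add: TT_def openin_inverse)
qed

section \<open>The circle group and quasi-convexity\<close>

lemma continuous_map_TT_iff:
  "continuous_map X (tg_top TT) f \<longleftrightarrow> f \<in> topspace X \<rightarrow> {0..<1} \<and>
     (\<forall>x\<in>topspace X. \<forall>e>0. \<exists>U. openin X U \<and> x \<in> U \<and> (\<forall>y\<in>U. tnorm (f y - f x) < e))"
  (is "?l \<longleftrightarrow> ?r")
proof
  assume l: ?l
  then have f: "f \<in> topspace X \<rightarrow> {0..<1}" by (auto simp: continuous_map_def top_TT)
  moreover have "\<exists>U. openin X U \<and> x \<in> U \<and> (\<forall>y\<in>U. tnorm (f y - f x) < e)"
    if x: "x \<in> topspace X" and e: "e > 0" for x e
  proof (intro exI conjI)
    show "openin X {y \<in> topspace X. f y \<in> circle.mball (f x) e}"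
      using l by (auto simp: continuous_map_def top_TT)
    show "x \<in> {y \<in> topspace X. f y \<in> circle.mball (f x) e}"
      using x e f by (auto simp: Pi_iff)
    show "\<forall>y\<in>{y \<in> topspace X. f y \<in> circle.mball (f x) e}. tnorm (f y - f x) < e"
      using circle.commute by auto
  qed
  ultimately show ?r by blast
next
  assume r: ?r
  show ?l
    unfolding continuous_map_def top_TT
  proof (intro conjI allI impI)
    show "f \<in> topspace X \<rightarrow> topspace circle.mtopology" using r by simp
    fix U assume U: "openin circle.mtopology U"
    show "openin X {x \<in> topspace X. f x \<in> U}"
    proof (subst openin_subopen, intro ballI)
      fix x assume x: "x \<in> {x \<in> topspace X. f x \<in> U}"
      then obtain e where e: "e > 0" "circle.mball (f x) e \<subseteq> U"
        using U by (auto simp: circle.openin_mtopology)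
      then obtain V where V: "openin X V" "x \<in> V" "\<forall>y\<in>V. tnorm (f y - f x) < e"
        using r x by blast
      have "V \<subseteq> {x \<in> topspace X. f x \<in> U}"
      proof
        fix y assume y: "y \<in> V"
        then have t: "y \<in> topspace X" using V openin_subset by blast
        then have "f y \<in> circle.mball (f x) e"
          using V y r x circle.commute[of "f x" "f y"] by (auto simp: Pi_iff)
        then show "y \<in> {x \<in> topspace X. f x \<in> U}" using e t by blast
      qed
      then show "\<exists>T. openin X T \<and> x \<in> T \<and> T \<subseteq> {x \<in> topspace X. f x \<in> U}"
        using V by blast
    qed
  qed
qed

lemma continuous_map_TT_near:
  assumes "continuous_map X (tg_top TT) f" "x \<in> topspace X" "e > 0"
  shows "\<exists>U. openin X U \<and> x \<in> U \<and> (\<forall>y\<in>U. tnorm (f y - f x) < e)"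
  using assms(1)[unfolded continuous_map_TT_iff, THEN conjunct2, rule_format, OF assms(2,3)] .

lemma continuous_map_int_iff:
  fixes f :: "'b \<Rightarrow> int"
  shows "continuous_map X euclidean f \<longleftrightarrow>
    (\<forall>x\<in>topspace X. \<exists>U. openin X U \<and> x \<in> U \<and> (\<forall>y\<in>U. f y = f x))" (is "?l \<longleftrightarrow> ?r")
proof
  assume l: ?l
  show ?r
  proof
    fix x assume x: "x \<in> topspace X"
    have "openin X {y \<in> topspace X. f y \<in> {f x}}"
      using l by (rule openin_continuous_map_preimage) (simp add: open_discrete)
    then show "\<exists>U. openin X U \<and> x \<in> U \<and> (\<forall>y\<in>U. f y = f x)" using x by blast
  qed
next
  assume r: ?r
  show ?l
    unfolding continuous_map_def
  proof (intro conjI allI impI)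
    fix U :: "int set"
    show "openin X {x \<in> topspace X. f x \<in> U}"
    proof (subst openin_subopen, intro ballI)
      fix x assume x: "x \<in> {x \<in> topspace X. f x \<in> U}"
      then obtain V where V: "openin X V" "x \<in> V" "\<forall>y\<in>V. f y = f x" using r by blast
      have "V \<subseteq> {x \<in> topspace X. f x \<in> U}" using openin_subset[OF V(1)] V(3) x by auto
      then show "\<exists>T. openin X T \<and> x \<in> T \<and> T \<subseteq> {x \<in> topspace X. f x \<in> U}"
        using V by blast
    qed
  qed simp
qed

lemma frac_mem [simp]: "frac x \<in> {0..<1}"
  by (simp add: frac_lt_1)

lemma continuous_map_TT_mult_int:
  fixes n :: "'b \<Rightarrow> int"
  assumes "continuous_map X euclidean n"
  shows "continuous_map X (tg_top TT) (\<lambda>x. frac (t * of_int (n x)))"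
  unfolding continuous_map_TT_iff
proof (intro conjI ballI allI impI)
  fix x and e :: real assume x: "x \<in> topspace X" and e: "e > 0"
  obtain U where U: "openin X U" "x \<in> U" "\<forall>y\<in>U. n y = n x"
    using assms[unfolded continuous_map_int_iff, rule_format, OF x] by (elim exE conjE)
  show "\<exists>U. openin X U \<and> x \<in> U \<and>
      (\<forall>y\<in>U. tnorm (frac (t * of_int (n y)) - frac (t * of_int (n x))) < e)"
  proof (intro exI conjI ballI)
    fix y assume "y \<in> U"
    then have "n y = n x" using U(3) by (rule bspec[rotated])
    then show "tnorm (frac (t * of_int (n y)) - frac (t * of_int (n x))) < e" using e by simp
  qed (fact U)+
qed (simp add: Pi_iff frac_lt_1)

lemma continuous_map_TT_add:
  assumes "continuous_map X (tg_top TT) f" "continuous_map X (tg_top TT) g"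
  shows "continuous_map X (tg_top TT) (\<lambda>x. frac (f x + g x))"
  unfolding continuous_map_TT_iff
proof (intro conjI ballI allI impI)
  fix x and e :: real assume x: "x \<in> topspace X" and e: "e > 0"
  obtain U where U: "openin X U" "x \<in> U" "\<And>y. y \<in> U \<Longrightarrow> tnorm (f y - f x) < e/2"
    using continuous_map_TT_near[OF assms(1) x half_gt_zero[OF e]] by blast
  obtain V where V: "openin X V" "x \<in> V" "\<And>y. y \<in> V \<Longrightarrow> tnorm (g y - g x) < e/2"
    using continuous_map_TT_near[OF assms(2) x half_gt_zero[OF e]] by blast
  have "tnorm (frac (f y + g y) - frac (f x + g x)) < e" if "y \<in> U \<inter> V" for y
  proof -
    have "tnorm (f y + g y - (f x + g x)) \<le> tnorm (f y - f x) + tnorm (g y - g x)"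
      using tnorm_triangle[of "f y - f x" "g y - g x"] by (simp add: algebra_simps)
    moreover have "tnorm (f y - f x) < e/2" "tnorm (g y - g x) < e/2" using U V that by auto
    ultimately show ?thesis unfolding tnorm_frac_diff by linarith
  qed
  then show "\<exists>U. openin X U \<and> x \<in> U \<and> (\<forall>y\<in>U. tnorm (frac (f y + g y) - frac (f x + g x)) < e)"
    using U V by (intro exI[of _ "U \<inter> V"]) auto
qed (auto simp: frac_lt_1)

lemma continuous_map_TT_int_mult:
  assumes "continuous_map X (tg_top TT) f"
  shows "continuous_map X (tg_top TT) (\<lambda>x. frac (of_int n * f x))"
  unfolding continuous_map_TT_iff
proof (intro conjI ballI allI impI)
  fix x and e :: real assume x: "x \<in> topspace X" and e: "e > 0"
  \<comment> \<open>The summand 1 keeps the denominator positive for \<open>n = 0\<close> and makes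
    the final estimate strict.\<close>
  define e' where "e' = e / (1 + real (nat \<bar>n\<bar>))"
  have "e' > 0" using e by (simp add: e'_def)
  obtain U where U: "openin X U" "x \<in> U" "\<And>y. y \<in> U \<Longrightarrow> tnorm (f y - f x) < e'"
    using continuous_map_TT_near[OF assms x \<open>e' > 0\<close>] by blast
  have "tnorm (frac (of_int n * f y) - frac (of_int n * f x)) < e" if "y \<in> U" for y
  proof -
    have "tnorm (of_int n * f y - of_int n * f x) = tnorm (real (nat \<bar>n\<bar>) * (f y - f x))"
      using tnorm_minus[of "of_int n * (f y - f x)"] by (cases "n \<ge> 0") (simp_all add: algebra_simps)
    also have "\<dots> \<le> real (nat \<bar>n\<bar>) * tnorm (f y - f x)" by (rule tnorm_multiple)
    also have "\<dots> \<le> real (nat \<bar>n\<bar>) * e'" using U that by (intro mult_left_mono) (auto simp: less_imp_le)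
    also have "\<dots> < (1 + real (nat \<bar>n\<bar>)) * e'" using \<open>e' > 0\<close> by (simp add: algebra_simps)
    also have "\<dots> = e" by (simp add: e'_def)
    finally show ?thesis unfolding tnorm_frac_diff .
  qed
  then show "\<exists>U. openin X U \<and> x \<in> U \<and>
      (\<forall>y\<in>U. tnorm (frac (of_int n * f y) - frac (of_int n * f x)) < e)"
    using U by (intro exI[of _ U]) auto
qed (auto simp: frac_lt_1)

lemma openin_TT_preimage_ball:
  assumes f: "continuous_map X (tg_top TT) f" and c: "c \<in> {0..<1}"
  shows "openin X {x \<in> topspace X. tnorm (f x - c) < e}"
proof -
  have "openin X {x \<in> topspace X. f x \<in> circle.mball c e}"
    using f by (auto simp: continuous_map_def top_TT)
  moreover have "{x \<in> topspace X. f x \<in> circle.mball c e} = {x \<in> topspace X. tnorm (f x - c) < e}"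
    using c f circle.commute by (auto simp: continuous_map_TT_iff Pi_iff)
  ultimately show ?thesis by simp
qed

section \<open>Characters of topological abelian groups\<close>

lemma tag_topspace: "top_ab_group G \<Longrightarrow> topspace (tg_top G) = tg_carrier G"
  by (simp add: top_ab_group_def)

lemma character_cont: "character G ch \<Longrightarrow> continuous_map (tg_top G) (tg_top TT) ch"
  by (simp add: character_def cont_hom_def)

lemma character_mem: "character G ch \<Longrightarrow> x \<in> tg_carrier G \<Longrightarrow> ch x \<in> {0..<1}"
  unfolding character_def cont_hom_def by simp

lemma character_add:
  "character G ch \<Longrightarrow> x \<in> tg_carrier G \<Longrightarrow> y \<in> tg_carrier G \<Longrightarrow>
    ch (tg_add G x y) = frac (ch x + ch y)"
  by (simp add: character_def cont_hom_def)

lemma character_add_Ints: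
  assumes "character G ch" "x \<in> tg_carrier G" "y \<in> tg_carrier G"
  shows "ch (tg_add G x y) - (ch x + ch y) \<in> \<int>"
  using assms by (simp add: character_add frac_diff_Ints)

lemma frac_sum_zero: "x \<in> {0..<1} \<Longrightarrow> x = frac (x + x) \<Longrightarrow> x = 0" for x :: real
  using frac_diff_Ints(1)[of "x + x"] frac_eq_iff[of x 0] by auto

lemma character_zero:
  assumes "top_ab_group G" "character G ch"
  shows "ch (tg_zero G) = 0"
proof -
  have z: "tg_zero G \<in> tg_carrier G" "tg_add G (tg_zero G) (tg_zero G) = tg_zero G"
    using assms by (auto simp: top_ab_group_def)
  then show ?thesis using character_add[OF assms(2) z(1) z(1)] character_mem[OF assms(2) z(1)]
    by (intro frac_sum_zero) auto
qed

lemma character_int_mult: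
  assumes "character G ch"
  shows "character G (\<lambda>x. frac (of_int n * ch x))"
  unfolding character_def cont_hom_def
proof (intro conjI ballI)
  fix x y assume xy: "x \<in> tg_carrier G" "y \<in> tg_carrier G"
  obtain k where "ch (tg_add G x y) = ch x + ch y + of_int k"
    using character_add_Ints[OF assms xy] by (metis Ints_cases add.commute diff_add_cancel)
  then show "frac (of_int n * ch (tg_add G x y)) = tg_add TT (frac (of_int n * ch x)) (frac (of_int n * ch y))"
    by (simp add: frac_eq_iff algebra_simps)
qed (simp_all add: frac_lt_1 continuous_map_TT_int_mult character_cont[OF assms])

section \<open>Polars and a criterion for membership in Q\<close>

lemma quasi_convex_polar:
  assumes "\<And>ch. ch \<in> S \<Longrightarrow> character G ch"
  shows "quasi_convex G {x \<in> tg_carrier G. \<forall>ch\<in>S. tnorm (ch x) \<le> 1/4}"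
  unfolding quasi_convex_def
proof (intro conjI ballI)
  fix g assume "g \<in> tg_carrier G - {x \<in> tg_carrier G. \<forall>ch\<in>S. tnorm (ch x) \<le> 1/4}"
  then obtain ch where "ch \<in> S" "\<not> tnorm (ch g) \<le> 1/4" by blast
  then show "\<exists>ch. character G ch \<and>
      (\<forall>a\<in>{x \<in> tg_carrier G. \<forall>ch\<in>S. tnorm (ch x) \<le> 1/4}. tnorm (ch a) \<le> 1/4) \<and> tnorm (ch g) > 1/4"
    using assms by (intro exI[of _ ch]) auto
qed auto

text \<open>The multiples \<open>k \<cdot> ch\<close> with \<open>k \<le> n\<close> turn the fixed bound 1/4 of quasi-convexity
  into the arbitrarily small bound \<open>1/(4n)\<close>.\<close>
lemma in_Q_weak:
  assumes G: "top_ab_group G" and H: "Hausdorff_space (tg_top G)"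
    and base: "\<And>U. openin (tg_top G) U \<Longrightarrow> tg_zero G \<in> U \<Longrightarrow>
      \<exists>S e. finite S \<and> e > 0 \<and> (\<forall>ch\<in>S. character G ch) \<and>
        {x \<in> tg_carrier G. \<forall>ch\<in>S. tnorm (ch x) < e} \<subseteq> U"
  shows "in_Q G"
  unfolding in_Q_def
proof (intro conjI allI impI G H)
  fix U assume "openin (tg_top G) U \<and> tg_zero G \<in> U"
  then obtain S e where S: "finite S" "e > 0" "\<forall>ch\<in>S. character G ch"
    "{x \<in> tg_carrier G. \<forall>ch\<in>S. tnorm (ch x) < e} \<subseteq> U"
    using base by meson
  obtain n :: nat where n: "n > 0" "1 / real n < e"
    using nat_approx_posE[OF S(2)] by (metis of_nat_Suc zero_less_Suc)
  define S' where "S' = {\<lambda>x. frac (of_int (int k) * ch x) | k ch. ch \<in> S \<and> 1 \<le> k \<and> k \<le> n}"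
  define V where "V = {x \<in> tg_carrier G. \<forall>ch\<in>S'. tnorm (ch x) \<le> 1/4}"
  \<comment> \<open>For \<open>k\<close> up to \<open>n\<close>, the radius 1/(4n) keeps
    \<open>k\<close> times a character value within 1/4, so \<open>W\<close> lies in the polar
    \<open>V\<close>. The intersection with the whole space covers the case of empty
    \<open>S\<close>.\<close>
  define W where "W = topspace (tg_top G) \<inter> (\<Inter>ch\<in>S. {x \<in> topspace (tg_top G). tnorm (ch x - 0) < 1 / (4 * real n)})"
  show "\<exists>V W. quasi_convex G V \<and> openin (tg_top G) W \<and> tg_zero G \<in> W \<and> W \<subseteq> V \<and> V \<subseteq> U"
  proof (intro exI conjI)
    show "quasi_convex G V"
      unfolding V_def using S(3) character_int_mult
      by (intro quasi_convex_polar) (auto simp: S'_def simp del: of_int_of_nat_eq)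
    have "openin (tg_top G) {x \<in> topspace (tg_top G). tnorm (ch x - 0) < 1 / (4 * real n)}" if "ch \<in> S" for ch
      using S that by (intro openin_TT_preimage_ball character_cont) auto
    then show "openin (tg_top G) W" unfolding W_def using S
      by (subst Int_commute) (rule openin_INT; simp)
    show "tg_zero G \<in> W"
    proof -
      have "tnorm (ch (tg_zero G) - 0) < 1 / (4 * real n)" if "ch \<in> S" for ch
      proof -
        have "ch (tg_zero G) = 0" using S(3) that character_zero[OF G] by blast
        then show ?thesis using n by simp
      qed
      moreover have "tg_zero G \<in> topspace (tg_top G)" using G by (simp add: top_ab_group_def)
      ultimately show ?thesis using n by (auto simp: W_def)
    qed
    show "W \<subseteq> V"
    proof
      fix x assume x: "x \<in> W"
      have "tnorm (real k * ch x) \<le> 1/4" if "ch \<in> S" "k \<le> n" for k ch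
      proof -
        have "tnorm (real k * ch x) \<le> real k * tnorm (ch x)" by (rule tnorm_multiple)
        also have "\<dots> \<le> real n * (1 / (4 * real n))"
          using x that by (intro mult_mono) (auto simp: W_def tnorm_ge_0 less_imp_le)
        also have "\<dots> = 1/4" using n by simp
        finally show ?thesis .
      qed
      then show "x \<in> V" using x tag_topspace[OF G] by (auto simp: V_def W_def S'_def)
    qed
    show "V \<subseteq> U"
    proof
      fix x assume x: "x \<in> V"
      have "tnorm (ch x) < e" if "ch \<in> S" for ch
      proof -
        have "tnorm (real k * ch x) \<le> 1/4" if "1 \<le> k" "k \<le> n" for k
        proof -
          have "(\<lambda>x. frac (of_int (int k) * ch x)) \<in> S'" using that \<open>ch \<in> S\<close> unfolding S'_def by blast
          then have "tnorm (frac (of_int (int k) * ch x)) \<le> 1/4" using x unfolding V_def by fast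
          then show ?thesis by simp
        qed
        then have "tnorm (ch x) \<le> 1 / (4 * real n)" using n by (intro tnorm_small_multiples) auto
        also have "\<dots> \<le> 1 / real n" using n by (simp add: field_simps)
        finally show ?thesis using n by simp
      qed
      then show "x \<in> U" using S x by (auto simp: V_def)
    qed
  qed
qed

lemma top_ab_group_TT: "top_ab_group TT"
  unfolding top_ab_group_def
proof (intro conjI ballI)
  show "continuous_map (prod_topology (tg_top TT) (tg_top TT)) (tg_top TT) (\<lambda>(x, y). tg_add TT x y)"
    using continuous_map_TT_add[OF continuous_map_fst continuous_map_snd]
    by (simp add: case_prod_unfold)
  show "continuous_map (tg_top TT) (tg_top TT) (tg_neg TT)"
    using continuous_map_TT_int_mult[OF continuous_map_id[unfolded id_def], of "- 1"]
    by (rule continuous_map_eq) auto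
qed (simp_all add: top_TT frac_lt_1 add.assoc, simp add: add.commute)

lemma in_Q_TT: "in_Q TT"
proof (rule in_Q_weak[OF top_ab_group_TT])
  show "Hausdorff_space (tg_top TT)" by (simp add: top_TT circle.Hausdorff_space_mtopology)
  fix U assume "openin (tg_top TT) U" "tg_zero TT \<in> U"
  then obtain e where e: "e > 0" "circle.mball 0 e \<subseteq> U"
    by (auto simp: top_TT circle.openin_mtopology)
  have "character TT (\<lambda>x. x)" unfolding character_def cont_hom_def
    using continuous_map_id[unfolded id_def] by auto
  moreover have "{x \<in> tg_carrier TT. tnorm x < e} \<subseteq> U"
    using e tnorm_minus by auto
  ultimately show "\<exists>S e. finite S \<and> e > 0 \<and> (\<forall>ch\<in>S. character TT ch) \<and>
        {x \<in> tg_carrier TT. \<forall>ch\<in>S. tnorm (ch x) < e} \<subseteq> U"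
    using e by (intro exI[of _ "{\<lambda>x. x}"] exI[of _ e]) auto
qed

section \<open>Characters of the circle\<close>

lemma int_mult_Ints_imp_zero:
  fixes k :: int and d :: real
  assumes "d > 0" and "\<And>t. 0 \<le> t \<Longrightarrow> t < d \<Longrightarrow> t < 1 \<Longrightarrow> of_int k * t \<in> \<int>"
  shows "k = 0"
proof (rule ccontr)
  assume k: "k \<noteq> 0"
  \<comment> \<open>Any positive \<open>t\<close> up to 1/(2|k|) makes \<open>k * t\<close> nonzero
    and at most 1/2 in absolute value, hence not an integer; the other bound keeps \<open>t\<close>
    below \<open>d\<close>.\<close>
  define t where "t = min (d/2) (1 / (2 * \<bar>of_int k\<bar>))"
  have k1: "\<bar>real_of_int k\<bar> \<ge> 1" using k by linarith
  have t: "t > 0" "t < d" using k assms(1) by (auto simp: t_def min_def)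
  have t2: "t \<le> 1 / (2 * \<bar>of_int k\<bar>)" by (simp add: t_def)
  also have "\<dots> < 1" using k1 by (simp add: field_simps)
  finally have "of_int k * t \<in> \<int>" using t assms(2)[of t] by simp
  moreover have "\<bar>of_int k * t\<bar> \<le> 1/2" using t2 t k1 by (simp add: abs_mult field_simps)
  ultimately have "of_int k * t = 0" using Ints_nonzero_abs_less1[of "of_int k * t"] by simp
  then show False using k t by simp
qed

text \<open>Real arguments of both signs describe a full neighbourhood of zero in the circle, whose
  representatives lie near 0 and near 1.\<close>

lemma TT_continuous_at_zero:
  assumes f: "character TT f" and e: "e > 0"
  shows "\<exists>d>0. \<forall>s. \<bar>s\<bar> < d \<longrightarrow> tnorm (f (frac s)) < e"
proof -
  have "openin (tg_top TT) {x \<in> topspace (tg_top TT). tnorm (f x - 0) < e}"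
    by (intro openin_TT_preimage_ball character_cont f) auto
  moreover have "0 \<in> {x \<in> topspace (tg_top TT). tnorm (f x - 0) < e}"
    using character_zero[OF top_ab_group_TT f] e by (simp add: top_TT)
  ultimately obtain d where d: "d > 0"
    "circle.mball 0 d \<subseteq> {x \<in> topspace (tg_top TT). tnorm (f x - 0) < e}"
    unfolding top_TT circle.openin_mtopology by blast
  have "tnorm (f (frac s)) < e" if "\<bar>s\<bar> < d" for s
  proof -
    have "tnorm (frac s) < d" using that tnorm_le_abs[of s] by simp
    then have "frac s \<in> circle.mball 0 d" by (simp add: tnorm_minus frac_lt_1)
    then have "frac s \<in> {x \<in> topspace (tg_top TT). tnorm (f x - 0) < e}" using d(2) by (rule subsetD[rotated])
    then show ?thesis by simp
  qed
  then show ?thesis using d(1) by blast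
qed

text \<open>Near zero a character lifts to reals \<open>y m\<close> representing its values at \<open>1/2^m\<close>, and the
  lifts satisfy \<open>y m = 2 * y (m + 1)\<close> exactly; hence it is linear at the dyadic rationals.\<close>
lemma character_TT_eq_int_mult:
  assumes f: "character TT f"
  shows "\<exists>n::int. \<forall>t\<in>{0..<1}. f t = frac (of_int n * t)"
proof -
  define F where "F r = f (frac r)" for r
  have F_add: "F (r + s) - (F r + F s) \<in> \<int>" for r s
    using character_add_Ints[OF f, of "frac r" "frac s"] by (simp add: F_def frac_lt_1)
  have F_mult: "F (real k * r) - real k * F r \<in> \<int>" for k r
  proof (induction k)
    case 0
    then show ?case using character_zero[OF top_ab_group_TT f] by (simp add: F_def)
  next
    case (Suc k)
    have "F (real (Suc k) * r) - real (Suc k) * F r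
        = (F (real k * r + r) - (F (real k * r) + F r)) + (F (real k * r) - real k * F r)"
      by (simp add: algebra_simps)
    then show ?case using Ints_add[OF F_add Suc] by (simp only:)
  qed
  have F_cont: "\<exists>d>0. \<forall>s. \<bar>s\<bar> < d \<longrightarrow> tnorm (F s) < e" if "e > 0" for e
    unfolding F_def by (rule TT_continuous_at_zero[OF f that])
  have quarter: "(0::real) < 1/4" by simp
  obtain d where d: "d > 0" "\<forall>s. \<bar>s\<bar> < d \<longrightarrow> tnorm (F s) < 1/4"
    using F_cont[OF quarter] by (elim exE conjE)
  obtain M where M: "(1/2) ^ M < d" using real_arch_pow_inv[OF d(1), of "1/2"] by auto
  define p :: "nat \<Rightarrow> real" where "p m = (1/2) ^ m" for m
  have p: "p m > 0" "p m = 2 * p (Suc m)" "2 ^ m * p m = 1" for m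
    by (simp_all add: p_def power_one_over)
  have p_small: "p m < d" if "M \<le> m" for m
  proof -
    have "p m \<le> p M" using that unfolding p_def by (intro power_decreasing) auto
    then show ?thesis using M unfolding p_def by linarith
  qed
  have "\<exists>y. \<bar>y\<bar> = tnorm (F (p m)) \<and> F (p m) - y \<in> \<int>" for m
  proof -
    obtain n where "n \<in> \<int>" "tnorm (F (p m)) = \<bar>F (p m) - n\<bar>" using tnorm_attained by blast
    then show ?thesis by (intro exI[of _ "F (p m) - n"]) auto
  qed
  then obtain y where y: "\<And>m. \<bar>y m\<bar> = tnorm (F (p m))" "\<And>m. F (p m) - y m \<in> \<int>" by metis
  \<comment> \<open>Both lifts are below 1/4 in absolute value, so the difference is below 3/4;
    being an integer, it is 0.\<close>
  have y_half: "y m = 2 * y (Suc m)" if "M \<le> m" for m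
  proof -
    have "tnorm (F (p m)) < 1/4" "tnorm (F (p (Suc m))) < 1/4"
      using that p_small[of m] p_small[of "Suc m"] p(1)[of m] p(1)[of "Suc m"]
        d(2)[THEN spec, of "p m"] d(2)[THEN spec, of "p (Suc m)"] by auto
    then have small: "\<bar>y m - 2 * y (Suc m)\<bar> < 1" using y(1)[of m] y(1)[of "Suc m"] by linarith
    have "y m - 2 * y (Suc m) = (F (p m) - real 2 * F (p (Suc m)))
        - (F (p m) - y m) + 2 * (F (p (Suc m)) - y (Suc m))" by simp
    also have "\<dots> \<in> \<int>"
    proof -
      have 1: "F (p m) - real 2 * F (p (Suc m)) \<in> \<int>" using F_mult[of 2 "p (Suc m)"] p(2)[of m] by simp
      have 2: "2 * (F (p (Suc m)) - y (Suc m)) \<in> \<int>"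
        using y(2)[of "Suc m"] Ints_mult[OF Ints_numeral] by blast
      show ?thesis by (rule Ints_add[OF Ints_diff[OF 1 y(2)] 2])
    qed
    finally show ?thesis using small Ints_nonzero_abs_less1[of "y m - 2 * y (Suc m)"] by simp
  qed
  \<comment> \<open>The slope of the line through the origin with value \<open>y M\<close> at
    \<open>p M\<close>, since \<open>p M\<close> is 1/2^M.\<close>
  define c where "c = 2 ^ M * y M"
  have y_eq: "y (M + k) = c * p (M + k)" for k
  proof (induction k)
    case 0
    have "c * p M = y M * (2 ^ M * p M)" unfolding c_def by (simp only: mult_ac)
    then show ?case unfolding p(3) by simp
  next
    case (Suc k)
    have "2 * y (Suc (M + k)) = 2 * (c * p (Suc (M + k)))"
      using Suc y_half[of "M + k"] unfolding p(2)[of "M + k"] by (simp add: algebra_simps)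
    then show ?case by simp
  qed
  have dyadic: "F (real j * p m) - c * (real j * p m) \<in> \<int>" if "M \<le> m" for j m
  proof -
    have "y m = c * p m" using y_eq[of "m - M"] that by simp
    then have "F (real j * p m) - c * (real j * p m)
        = (F (real j * p m) - real j * F (p m)) + real j * (F (p m) - y m)"
      by (simp only: right_diff_distrib mult.left_commute)
    then show ?thesis using Ints_add[OF F_mult[of j "p m"] Ints_mult[OF Ints_of_nat[of j] y(2)[of m]]]
      by (simp only:)
  qed
  \<comment> \<open>At the dyadic point 1, which represents zero of the circle, linearity forces the
    slope to be an integer.\<close>
  have one: "real (2 ^ M) * p M = 1" using p(3)[of M] by simp
  have "F 1 - c \<in> \<int>" using dyadic[of M "2 ^ M"] unfolding one by simp
  moreover have "F 1 = 0" using character_zero[OF top_ab_group_TT f] by (simp add: F_def)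
  ultimately have "c \<in> \<int>" using minus_in_Ints_iff[of c] by simp
  then obtain n where n: "c = of_int n" by (rule Ints_cases)
  have "f t = frac (of_int n * t)" if t: "t \<in> {0..<1}" for t
  proof -
    have "tnorm (f t - c * t) \<le> 0"
    proof (rule field_le_epsilon)
      fix e :: real assume e: "e > 0"
      obtain d' where d': "d' > 0" "\<forall>s. \<bar>s\<bar> < d' \<longrightarrow> tnorm (F s) < e/2"
        using F_cont[OF half_gt_zero[OF e]] by (elim exE conjE)
      \<comment> \<open>Offsets smaller than \<open>q\<close> contribute at most e/2 through
        \<open>F\<close> and at most e/2 through the linear term; \<open>1 + \<bar>c\<bar>\<close>
        avoids division by zero.\<close>
      define q where "q = min d' (e / (2 * (1 + \<bar>c\<bar>)))"
      have "q > 0" using d' e by (simp add: q_def min_def)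
      then obtain m0 where m0: "(1/2) ^ m0 < q" using real_arch_pow_inv[of q "1/2"] by auto
      define m where "m = max M m0"
      have pm: "p m < q"
      proof -
        have "p m \<le> (1/2) ^ m0" unfolding p_def m_def by (intro power_decreasing) auto
        then show ?thesis using m0 by simp
      qed
      \<comment> \<open>\<open>j * p m\<close> is the largest multiple of 1/2^m not exceeding
        \<open>t\<close>, so the remainder \<open>s\<close> is at most \<open>p m\<close>.\<close>
      define j where "j = nat \<lfloor>t * 2 ^ m\<rfloor>"
      define s where "s = t - real j * p m"
      have j: "real j \<le> t * 2 ^ m" "t * 2 ^ m < real j + 1"
        using t by (auto simp: j_def)
      have "s = (t * 2 ^ m - real j) * p m"
        using p(3)[of m] by (simp add: s_def algebra_simps)
      then have s: "\<bar>s\<bar> \<le> p m" using j p(1)[of m] by (simp add: abs_mult mult_left_le_one_le)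
      have "(f t - c * t) - (F s - c * s)
          = (F (real j * p m + s) - (F (real j * p m) + F s)) + (F (real j * p m) - c * (real j * p m))"
        using t by (simp add: s_def F_def algebra_simps)
      also have "\<dots> \<in> \<int>" using F_add dyadic[of m j] by (intro Ints_add) (auto simp: m_def)
      finally have "tnorm (f t - c * t) = tnorm (F s + - (c * s))" by (intro tnorm_cong) simp
      also have "\<dots> \<le> tnorm (F s) + \<bar>c * s\<bar>"
        using tnorm_triangle[of "F s" "- (c * s)"] tnorm_le_abs[of "- (c * s)"] by simp
      also have "\<bar>c * s\<bar> \<le> (1 + \<bar>c\<bar>) * q"
        unfolding abs_mult using s pm by (intro mult_mono) auto
      also have "\<dots> \<le> (1 + \<bar>c\<bar>) * (e / (2 * (1 + \<bar>c\<bar>)))"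
        by (intro mult_left_mono) (auto simp: q_def)
      also have "\<dots> = e/2"
      proof -
        have "a * (e / (2 * a)) = e/2" if "a \<noteq> 0" for a :: real using that by simp
        then show ?thesis by this linarith
      qed
      also have "tnorm (F s) \<le> e/2" using s pm d'(2)[THEN spec, of s] by (simp add: q_def)
      finally show "tnorm (f t - c * t) \<le> 0 + e" by simp
    qed
    then have "tnorm (f t - c * t) = 0" using tnorm_ge_0 by (rule order_antisym)
    then have "f t - of_int n * t \<in> \<int>" by (simp add: tnorm_eq_0 n)
    then show ?thesis using character_mem[OF f] t frac_eq_iff[of "f t" "of_int n * t"] by simp
  qed
  then show ?thesis by blast
qed

section \<open>The pairing\<close>

lemma pairing_eq_sum:
  assumes "finite F" "{i. g i \<noteq> 0} \<subseteq> F"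
  shows "pairing g x = (\<Sum>i\<in>F. g i * x i)"
  unfolding pairing_def using assms by (intro sum.mono_neutral_left) auto

lemma finite_supp: "g \<in> fin_supp I \<Longrightarrow> finite {i. g i \<noteq> 0}"
  by (simp add: fin_supp_def)

lemma fin_supp_zero: "(\<lambda>i. 0) \<in> fin_supp I"
  by (simp add: fin_supp_def)

lemma fin_supp_add:
  assumes "g \<in> fin_supp I" "h \<in> fin_supp I"
  shows "(\<lambda>i. g i + h i) \<in> fin_supp I"
proof -
  have "finite {i. g i + h i \<noteq> 0}"
    by (rule finite_subset[of _ "{i. g i \<noteq> 0} \<union> {i. h i \<noteq> 0}"]) (use assms in \<open>auto simp: fin_supp_def\<close>)
  then show ?thesis using assms by (simp add: fin_supp_def)
qed

lemma fin_supp_mult: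
  assumes "g \<in> fin_supp I"
  shows "(\<lambda>i. k * g i) \<in> fin_supp I"
proof -
  have "finite {i. k * g i \<noteq> 0}"
    by (rule finite_subset[of _ "{i. g i \<noteq> 0}"]) (use assms in \<open>auto simp: fin_supp_def\<close>)
  then show ?thesis using assms by (simp add: fin_supp_def)
qed

lemma pairing_add_left:
  assumes "g \<in> fin_supp I" "h \<in> fin_supp I"
  shows "pairing (\<lambda>i. g i + h i) x = pairing g x + pairing h x"
proof -
  define F where "F = {i. g i \<noteq> 0} \<union> {i. h i \<noteq> 0}"
  have F: "finite F" using assms by (simp add: F_def fin_supp_def)
  have "pairing (\<lambda>i. g i + h i) x = (\<Sum>i\<in>F. (g i + h i) * x i)"
    using F by (rule pairing_eq_sum) (auto simp: F_def)
  moreover have "pairing g x = (\<Sum>i\<in>F. g i * x i)" "pairing h x = (\<Sum>i\<in>F. h i * x i)"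
    using F by (auto intro!: pairing_eq_sum simp: F_def)
  ultimately show ?thesis by (simp add: sum.distrib algebra_simps)
qed

lemma pairing_mult_left:
  assumes "g \<in> fin_supp I"
  shows "pairing (\<lambda>i. k * g i) x = k * pairing g x"
proof -
  have "pairing (\<lambda>i. k * g i) x = (\<Sum>i\<in>{i. g i \<noteq> 0}. (k * g i) * x i)"
    using finite_supp[OF assms] by (rule pairing_eq_sum) auto
  then show ?thesis by (simp add: pairing_def sum_distrib_left mult.assoc)
qed

lemma pairing_zero_left: "pairing (\<lambda>i. 0) x = 0"
  by (simp add: pairing_def)

lemma pairing_add_right:
  assumes "g \<in> fin_supp I"
  shows "pairing g (\<lambda>i\<in>I. x i + y i) = pairing g x + pairing g y"
proof -
  have "pairing g (\<lambda>i\<in>I. x i + y i) = (\<Sum>i\<in>{i. g i \<noteq> 0}. g i * x i + g i * y i)"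
    unfolding pairing_def using assms
    by (intro sum.cong) (auto simp: fin_supp_def restrict_def algebra_simps)
  then show ?thesis by (simp add: pairing_def sum.distrib)
qed

section \<open>The product group\<close>

lemma ZI_sel [simp]:
  "tg_carrier (ZI I) = (\<Pi>\<^sub>E i\<in>I. UNIV)"
  "tg_add (ZI I) x y = (\<lambda>i\<in>I. x i + y i)"
  "tg_zero (ZI I) = (\<lambda>i\<in>I. 0)"
  "tg_neg (ZI I) x = (\<lambda>i\<in>I. - x i)"
  "tg_top (ZI I) = product_topology (\<lambda>_. (euclidean :: int topology)) I"
  by (simp_all add: ZI_def)

lemma continuous_map_int_comp:
  fixes f :: "'b \<Rightarrow> int" and g :: "'b \<Rightarrow> int"
  assumes "continuous_map X euclidean f" "continuous_map X euclidean g"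
  shows "continuous_map X euclidean (\<lambda>x. h (f x) (g x) :: int)"
  unfolding continuous_map_int_iff
proof
  fix x assume x: "x \<in> topspace X"
  obtain U where U: "openin X U" "x \<in> U" "\<forall>y\<in>U. f y = f x"
    using assms(1)[unfolded continuous_map_int_iff, rule_format, OF x] by (elim exE conjE)
  obtain V where V: "openin X V" "x \<in> V" "\<forall>y\<in>V. g y = g x"
    using assms(2)[unfolded continuous_map_int_iff, rule_format, OF x] by (elim exE conjE)
  show "\<exists>U. openin X U \<and> x \<in> U \<and> (\<forall>y\<in>U. h (f y) (g y) = h (f x) (g x))"
  proof (intro exI conjI ballI)
    show "openin X (U \<inter> V)" using U(1) V(1) by (rule openin_Int)
    show "x \<in> U \<inter> V" using U(2) V(2) by (rule IntI)
    fix y assume y: "y \<in> U \<inter> V"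
    show "h (f y) (g y) = h (f x) (g x)"
      unfolding bspec[OF U(3) IntD1[OF y]] bspec[OF V(3) IntD2[OF y]] ..
  qed
qed

lemma continuous_map_ZI_proj:
  "i \<in> I \<Longrightarrow> continuous_map (tg_top (ZI I)) euclidean (\<lambda>x. x i)"
  unfolding ZI_sel by (rule continuous_map_product_projection)

lemma continuous_map_ZI_pairing:
  assumes "g \<in> fin_supp I"
  shows "continuous_map (tg_top (ZI I)) euclidean (pairing g)"
proof -
  have "continuous_map (tg_top (ZI I)) euclidean (\<lambda>x. \<Sum>i\<in>F. g i * x i)"
    if "finite F" "F \<subseteq> I" for F
    using that
  proof (induction F)
    case (insert i F)
    then show ?case
      using continuous_map_int_comp[OF continuous_map_ZI_proj[of i I], of _ "\<lambda>a b. g i * a + b"]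
      by simp
  qed simp
  then show ?thesis using assms unfolding pairing_def[abs_def] fin_supp_def by blast
qed

lemma top_ab_group_ZI: "top_ab_group (ZI I)"
  unfolding top_ab_group_def
proof (intro conjI ballI)
  have "continuous_map (prod_topology (tg_top (ZI I)) (tg_top (ZI I))) euclidean (\<lambda>p. fst p i + snd p i)"
    if "i \<in> I" for i
    using continuous_map_compose[OF continuous_map_fst continuous_map_ZI_proj[OF that]]
      continuous_map_compose[OF continuous_map_snd continuous_map_ZI_proj[OF that]]
    unfolding o_def by (rule continuous_map_int_comp)
  then show "continuous_map (prod_topology (tg_top (ZI I)) (tg_top (ZI I))) (tg_top (ZI I))
      (\<lambda>(x, y). tg_add (ZI I) x y)"
    by (auto simp: case_prod_unfold continuous_map_componentwise cong: restrict_cong)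
  have "continuous_map (tg_top (ZI I)) euclidean (\<lambda>x. - x i)" if "i \<in> I" for i
    using continuous_map_int_comp[OF continuous_map_ZI_proj[OF that] continuous_map_ZI_proj[OF that],
        of "\<lambda>a b. - a"] .
  then show "continuous_map (tg_top (ZI I)) (tg_top (ZI I)) (tg_neg (ZI I))"
    by (auto simp: continuous_map_componentwise)
qed (auto simp: algebra_simps restrict_def fun_eq_iff PiE_def extensional_def)

text \<open>A basic box around zero restricts finitely many coordinates, and vanishing there keeps a
  vector inside. Replacing the box by this subgroup is what allows passing to all multiples of a
  vector later.\<close>

lemma ZI_nbhd_zero:
  assumes "openin (tg_top (ZI I)) U" "tg_zero (ZI I) \<in> U"
  shows "\<exists>F. finite F \<and> F \<subseteq> I \<and> {x \<in> (\<Pi>\<^sub>E i\<in>I. UNIV). \<forall>i\<in>F. x i = 0} \<subseteq> U"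
proof -
  obtain X where X: "(\<lambda>i\<in>I. 0) \<in> Pi\<^sub>E I X" "\<And>i. openin (euclidean :: int topology) (X i)"
      "finite {i. X i \<noteq> topspace (euclidean :: int topology)}" "Pi\<^sub>E I X \<subseteq> U"
    using product_topology_open_contains_basis[of "\<lambda>_. euclidean :: int topology" I U "\<lambda>i\<in>I. 0"] assms
    by auto
  show ?thesis
  proof (intro exI conjI subsetI)
    show "finite ({i. X i \<noteq> UNIV} \<inter> I)" using X(3) by simp
    fix x :: "'a \<Rightarrow> int" assume x: "x \<in> {x \<in> (\<Pi>\<^sub>E i\<in>I. UNIV). \<forall>i\<in>{i. X i \<noteq> UNIV} \<inter> I. x i = 0}"
    have "x \<in> Pi\<^sub>E I X"
    proof (rule PiE_I)
      fix i assume i: "i \<in> I"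
      then have "0 \<in> X i" using X(1) by (auto simp: PiE_iff)
      then show "x i \<in> X i" using x i by (cases "X i = UNIV") auto
    qed (use x in auto)
    then show "x \<in> U" using X(4) by blast
  qed auto
qed

lemma openin_ZI_vanishing:
  assumes "finite F" "F \<subseteq> I"
  shows "openin (tg_top (ZI I)) {x \<in> (\<Pi>\<^sub>E i\<in>I. UNIV). \<forall>i\<in>F. x i = 0}"
proof -
  have "openin (tg_top (ZI I)) ((\<Inter>i\<in>F. {x \<in> topspace (tg_top (ZI I)). x i \<in> {0}}) \<inter> topspace (tg_top (ZI I)))"
    using assms by (intro openin_INT openin_continuous_map_preimage[OF continuous_map_ZI_proj])
      (auto simp: open_discrete)
  also have "(\<Inter>i\<in>F. {x \<in> topspace (tg_top (ZI I)). x i \<in> {0}}) \<inter> topspace (tg_top (ZI I))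
    = {x \<in> (\<Pi>\<^sub>E i\<in>I. UNIV). \<forall>i\<in>F. x i = 0}" by auto
  finally show ?thesis .
qed

lemma in_Q_ZI: "in_Q (ZI I)"
  unfolding in_Q_def
proof (intro conjI allI impI)
  show "top_ab_group (ZI I)" by (rule top_ab_group_ZI)
  have "Hausdorff_space (euclidean :: int topology)"
    unfolding Hausdorff_space_def
    by (intro allI impI, rule_tac x = "{x}" in exI, rule_tac x = "{y}" in exI) (simp add: open_discrete)
  then show "Hausdorff_space (tg_top (ZI I))"
    by (simp add: Hausdorff_space_product_topology)
  fix U assume "openin (tg_top (ZI I)) U \<and> tg_zero (ZI I) \<in> U"
  then have U: "openin (tg_top (ZI I)) U" "tg_zero (ZI I) \<in> U" by blast+
  obtain F where F: "finite F" "F \<subseteq> I"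
      "{x \<in> (\<Pi>\<^sub>E i\<in>I. UNIV). \<forall>i\<in>F. x i = 0} \<subseteq> U"
    using ZI_nbhd_zero[OF U] by (elim exE conjE)
  define S where "S = {\<lambda>x. frac (t * of_int (x i)) | (t :: real) i. i \<in> F}"
  define V where "V = {x \<in> (\<Pi>\<^sub>E i\<in>I. UNIV). \<forall>i\<in>F. x i = (0::int)}"
  have char: "character (ZI I) ch" if chS: "ch \<in> S" for ch
  proof -
    obtain t i where ch: "ch = (\<lambda>x. frac (t * of_int (x i)))" "i \<in> F" using chS unfolding S_def by blast
    then have i: "i \<in> I" using F by blast
    show ?thesis unfolding character_def cont_hom_def ch(1)
      using i continuous_map_TT_mult_int[OF continuous_map_ZI_proj[OF i], of t]
      by (auto simp: algebra_simps frac_lt_1)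
  qed
  have "V = {x \<in> tg_carrier (ZI I). \<forall>ch\<in>S. tnorm (ch x) \<le> 1/4}"
  proof (intro set_eqI iffI)
    fix x assume "x \<in> V"
    then show "x \<in> {x \<in> tg_carrier (ZI I). \<forall>ch\<in>S. tnorm (ch x) \<le> 1/4}"
      by (auto simp: V_def S_def)
  next
    fix x assume x: "x \<in> {x \<in> tg_carrier (ZI I). \<forall>ch\<in>S. tnorm (ch x) \<le> 1/4}"
    have "x i = 0" if i: "i \<in> F" for i
    proof (rule ccontr)
      assume nz: "x i \<noteq> 0"
      \<comment> \<open>For nonzero \<open>x i\<close>, the parameter 1/(2 x_i) gives the value 1/2,
        which violates the bound 1/4. The name \<open>x0\<close> separates the vector that fixes the
        parameter from the argument of the character.\<close>
      have "(\<lambda>x. frac (1 / (2 * of_int (x0 i)) * of_int (x i))) \<in> S" for x0 :: "'a \<Rightarrow> int"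
        using i unfolding S_def by blast
      then have "tnorm (frac (1 / (2 * of_int (x i)) * of_int (x i))) \<le> 1/4" using x by fast
      moreover have "tnorm (1/2) = 1/2" by (subst tnorm_eq_abs) auto
      ultimately show False using nz by simp
    qed
    then show "x \<in> V" using x by (simp add: V_def)
  qed
  then have "quasi_convex (ZI I) V" using quasi_convex_polar[of S "ZI I"] char by simp
  moreover have "openin (tg_top (ZI I)) V" unfolding V_def using F by (intro openin_ZI_vanishing)
  moreover have "tg_zero (ZI I) \<in> V" using F by (auto simp: V_def)
  moreover have "V \<subseteq> U" using F by (auto simp: V_def)
  ultimately show "\<exists>V W. quasi_convex (ZI I) V \<and> openin (tg_top (ZI I)) W \<and>
      tg_zero (ZI I) \<in> W \<and> W \<subseteq> V \<and> V \<subseteq> U" by blast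
qed

section \<open>Bihomomorphisms from Z^I and the circle into the circle\<close>

definition unit_vec :: "'a set \<Rightarrow> 'a \<Rightarrow> 'a \<Rightarrow> int" where
  "unit_vec I j = (\<lambda>i\<in>I. if i = j then 1 else 0)"

lemma unit_vec_mem: "unit_vec I j \<in> (\<Pi>\<^sub>E i\<in>I. UNIV)"
  by (simp add: unit_vec_def)

lemma pairing_unit_vec:
  assumes "g \<in> fin_supp I" "j \<in> I"
  shows "pairing g (unit_vec I j) = g j"
proof -
  have "pairing g (unit_vec I j) = (\<Sum>i\<in>{i. g i \<noteq> 0}. if i = j then g j else 0)"
    unfolding pairing_def unit_vec_def using assms
    by (intro sum.cong) (auto simp: fin_supp_def)
  also have "\<dots> = g j" using finite_supp[OF assms(1)] by (simp add: sum.delta)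
  finally show ?thesis .
qed

text \<open>Each \<open>b x\<close> is multiplication by an integer \<open>n x\<close>, and
  \<open>n\<close> is additive. If \<open>x\<close> vanishes on \<open>F\<close>, so do all its
  multiples, hence every multiple of \<open>n x * t\<close> stays within 1/4 of the integers; this
  forces \<open>n x * t\<close> to be an integer for all small \<open>t\<close>, so
  \<open>n x = 0\<close>. Thus \<open>n\<close> is determined by the coordinates in
  \<open>F\<close>. The set \<open>F\<close> is kept in the conclusion because many characters will
  later share it.\<close>

lemma ZI_TT_bihom_eq_pairing:
  fixes b :: "('a \<Rightarrow> int) \<Rightarrow> real \<Rightarrow> real"
  assumes char: "\<And>x. x \<in> (\<Pi>\<^sub>E i\<in>I. UNIV) \<Longrightarrow> character TT (b x)"
    and add: "\<And>x y t. x \<in> (\<Pi>\<^sub>E i\<in>I. UNIV) \<Longrightarrow> y \<in> (\<Pi>\<^sub>E i\<in>I. UNIV) \<Longrightarrow> t \<in> {0..<1} \<Longrightarrow>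
      b (\<lambda>i\<in>I. x i + y i) t = frac (b x t + b y t)"
    and F: "finite F" "F \<subseteq> I" and d: "d > 0"
    and small: "\<And>x t. x \<in> (\<Pi>\<^sub>E i\<in>I. UNIV) \<Longrightarrow> (\<And>i. i \<in> F \<Longrightarrow> x i = 0) \<Longrightarrow> 0 \<le> t \<Longrightarrow> t < d \<Longrightarrow> t < 1 \<Longrightarrow>
      tnorm (b x t) \<le> 1/4"
  shows "\<exists>g\<in>fin_supp I. (\<forall>i. i \<notin> F \<longrightarrow> g i = 0) \<and>
    (\<forall>x\<in>(\<Pi>\<^sub>E i\<in>I. UNIV). \<forall>t\<in>{0..<1}. b x t = frac (t * of_int (pairing g x)))"
proof -
  let ?Z = "(\<Pi>\<^sub>E i\<in>I. UNIV) :: ('a \<Rightarrow> int) set"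
  have "\<forall>x\<in>?Z. \<exists>n::int. \<forall>t\<in>{0..<1}. b x t = frac (of_int n * t)"
    using char character_TT_eq_int_mult by blast
  then obtain n where n: "\<And>x t. x \<in> ?Z \<Longrightarrow> t \<in> {0..<1} \<Longrightarrow> b x t = frac (of_int (n x) * t)"
    by metis
  have n_add: "n (\<lambda>i\<in>I. x i + y i) = n x + n y" if "x \<in> ?Z" "y \<in> ?Z" for x y
  proof -
    let ?s = "\<lambda>i\<in>I. x i + y i"
    have s: "?s \<in> ?Z" by simp
    \<comment> \<open>\<open>n\<close> is known only through its multiples modulo 1; letting
      \<open>t\<close> run through [0,1) recovers the integer itself.\<close>
    have "of_int (n ?s - (n x + n y)) * t \<in> \<int>" if t: "0 \<le> t" "t < 1" for t :: real
    proof -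
      have "frac (of_int (n ?s) * t) = frac (frac (of_int (n x) * t) + frac (of_int (n y) * t))"
        using add[OF \<open>x \<in> ?Z\<close> \<open>y \<in> ?Z\<close>, of t] t n[OF s] n[OF \<open>x \<in> ?Z\<close>] n[OF \<open>y \<in> ?Z\<close>] by simp
      then show ?thesis by (simp add: frac_eq_iff algebra_simps)
    qed
    then have "n ?s - (n x + n y) = 0" by (intro int_mult_Ints_imp_zero[of 1]) auto
    then show ?thesis by simp
  qed
  define m where "m k x = (\<lambda>i\<in>I. k * x i)" for k :: int and x
  have m_mem: "m k x \<in> ?Z" for k x by (simp add: m_def)
  have n_zero: "n (\<lambda>i\<in>I. 0) = 0" using n_add[of "\<lambda>i\<in>I. 0" "\<lambda>i\<in>I. 0"] by (simp cong: restrict_cong)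
  have m_Suc: "n (m (k + 1) x) = n (m k x) + n x" if "x \<in> ?Z" for k x
  proof -
    have "m (k + 1) x = (\<lambda>i\<in>I. m k x i + x i)" by (auto simp: m_def fun_eq_iff algebra_simps)
    then show ?thesis using n_add[OF m_mem that] by simp
  qed
  have n_mult: "n (m k x) = k * n x" if x: "x \<in> ?Z" for k x
  proof (induction k rule: int_induct[where k = 0])
    case base
    have "m 0 x = (\<lambda>i\<in>I. 0)" by (simp add: m_def)
    then show ?case by (simp only: n_zero mult_zero_left)
  next
    case (step1 i)
    then show ?case using m_Suc[OF x, of i] by (simp add: algebra_simps)
  next
    case (step2 i)
    then show ?case using m_Suc[OF x, of "i - 1"] by (simp add: algebra_simps)
  qed
  have n_vanish: "n x = 0" if x: "x \<in> ?Z" "\<And>i. i \<in> F \<Longrightarrow> x i = 0" for x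
  proof (rule int_mult_Ints_imp_zero[OF d])
    fix t :: real assume t: "0 \<le> t" "t < d" "t < 1"
    have "tnorm (real k * (of_int (n x) * t)) \<le> 1/4" for k
    proof -
      have "tnorm (b (m (int k) x) t) \<le> 1/4"
        using x(2) F(2) t by (intro small m_mem) (auto simp: m_def)
      then show ?thesis using n[OF m_mem] n_mult[OF x(1)] t by (simp add: mult.assoc)
    qed
    then show "of_int (n x) * t \<in> \<int>" by (rule tnorm_bounded_multiples)
  qed
  have n_sum: "n (\<lambda>i\<in>I. if i \<in> G then x i else 0) = (\<Sum>i\<in>G. x i * n (unit_vec I i))"
    if "finite G" "x \<in> ?Z" for G x
    using that(1)
  proof (induction G)
    case empty
    then show ?case by (simp only: empty_iff if_False n_zero sum.empty)
  next
    case (insert j G)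
    have "(\<lambda>i\<in>I. if i \<in> insert j G then x i else 0)
        = (\<lambda>i\<in>I. m (x j) (unit_vec I j) i + (\<lambda>i\<in>I. if i \<in> G then x i else 0) i)"
      using insert.hyps by (auto simp: m_def unit_vec_def fun_eq_iff)
    then have "n (\<lambda>i\<in>I. if i \<in> insert j G then x i else 0)
      = n (m (x j) (unit_vec I j)) + n (\<lambda>i\<in>I. if i \<in> G then x i else 0)"
      using n_add[OF m_mem, of "\<lambda>i\<in>I. if i \<in> G then x i else 0"] by simp
    then show ?case
      unfolding insert.IH n_mult[OF unit_vec_mem] sum.insert[OF insert.hyps] .
  qed
  define g where "g i = (if i \<in> F then n (unit_vec I i) else 0)" for i
  have sub: "{i. g i \<noteq> 0} \<subseteq> F" by (auto simp: g_def)
  have g: "g \<in> fin_supp I" using sub F finite_subset unfolding fin_supp_def by (auto simp: g_def)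
  have "n x = pairing g x" if x: "x \<in> ?Z" for x
  proof -
    \<comment> \<open>\<open>v\<close> lies in the subgroup on which \<open>n\<close> vanishes,
      while \<open>u\<close> is a finite combination of unit vectors.\<close>
    define u where "u = (\<lambda>i\<in>I. if i \<in> F then x i else 0)"
    define v where "v = (\<lambda>i\<in>I. if i \<in> F then 0 else x i)"
    have "x = (\<lambda>i\<in>I. u i + v i)" using x by (auto simp: u_def v_def fun_eq_iff PiE_def extensional_def)
    moreover have "n v = 0" using F by (intro n_vanish) (auto simp: v_def)
    moreover have "n u = pairing g x"
    proof -
      have "pairing g x = (\<Sum>i\<in>F. x i * n (unit_vec I i))"
        unfolding pairing_eq_sum[OF F(1) sub] by (intro sum.cong) (simp_all add: g_def mult.commute)
      then show ?thesis unfolding u_def n_sum[OF F(1) x] by (rule sym)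
    qed
    moreover have "u \<in> ?Z" "v \<in> ?Z" by (simp_all add: u_def v_def)
    ultimately show ?thesis using n_add[of u v] by simp
  qed
  then show ?thesis using g n by (intro bexI[of _ g]) (auto simp: g_def mult.commute)
qed

section \<open>The group of finitely supported functions\<close>

lemma HI_sel [simp]:
  "tg_carrier (HI I) = fin_supp I"
  "tg_add (HI I) g h = (\<lambda>i. g i + h i)"
  "tg_zero (HI I) = (\<lambda>i. 0)"
  by (simp_all add: HI_def)

lemma top_HI:
  "tg_top (HI I) = topology_generated_by
     {{g \<in> fin_supp I. pairing g x \<in> U} | x U. x \<in> (\<Pi>\<^sub>E i\<in>I. UNIV)}"
  by (simp add: HI_def)

lemma openin_HI_subbasis:
  assumes "x \<in> (\<Pi>\<^sub>E i\<in>I. UNIV)"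
  shows "openin (tg_top (HI I)) {g \<in> fin_supp I. pairing g x \<in> U}"
  unfolding top_HI using assms by (intro topology_generated_by_Basis) blast

lemma topspace_HI [simp]: "topspace (tg_top (HI I)) = fin_supp I"
proof
  show "topspace (tg_top (HI I)) \<subseteq> fin_supp I" unfolding top_HI topology_generated_by_topspace by blast
  have "openin (tg_top (HI I)) {g \<in> fin_supp I. pairing g (\<lambda>i\<in>I. 0) \<in> UNIV}"
    by (rule openin_HI_subbasis) simp
  then show "fin_supp I \<subseteq> topspace (tg_top (HI I))" using openin_subset by fastforce
qed

text \<open>Pairings are integers, so a subbasic condition at \<open>g\<close> can be sharpened to
  equality with the value at \<open>g\<close>. For \<open>g = 0\<close> the resulting neighbourhood
  is a subgroup, the common kernel of finitely many pairings.\<close>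

lemma openin_HI_near:
  assumes "openin (tg_top (HI I)) U" "g \<in> U"
  shows "\<exists>X. finite X \<and> X \<subseteq> (\<Pi>\<^sub>E i\<in>I. UNIV) \<and> {h \<in> fin_supp I. \<forall>x\<in>X. pairing h x = pairing g x} \<subseteq> U"
  using assms(1)[unfolded top_HI, THEN openin_topology_generated_by] assms(2)
proof (induction U rule: generate_topology_on.induct)
  case Empty
  then show ?case by simp
next
  case (Int a b)
  obtain X where X: "finite X" "X \<subseteq> (\<Pi>\<^sub>E i\<in>I. UNIV)"
      "{h \<in> fin_supp I. \<forall>x\<in>X. pairing h x = pairing g x} \<subseteq> a"
    using Int.IH(1) Int.prems by (elim IntE) blast
  obtain Y where Y: "finite Y" "Y \<subseteq> (\<Pi>\<^sub>E i\<in>I. UNIV)"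
      "{h \<in> fin_supp I. \<forall>x\<in>Y. pairing h x = pairing g x} \<subseteq> b"
    using Int.IH(2) Int.prems by (elim IntE) blast
  show ?case
  proof (intro exI conjI)
    show "finite (X \<union> Y)" using X(1) Y(1) by simp
    show "X \<union> Y \<subseteq> (\<Pi>\<^sub>E i\<in>I. UNIV)" using X(2) Y(2) by simp
    show "{h \<in> fin_supp I. \<forall>x\<in>X \<union> Y. pairing h x = pairing g x} \<subseteq> a \<inter> b"
      using X(3) Y(3) by blast
  qed
next
  case (UN K)
  then obtain k where k: "k \<in> K" "g \<in> k" by blast
  obtain X where X: "finite X" "X \<subseteq> (\<Pi>\<^sub>E i\<in>I. UNIV)"
      "{h \<in> fin_supp I. \<forall>x\<in>X. pairing h x = pairing g x} \<subseteq> k"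
    using UN.IH[OF k] by (elim exE conjE)
  have "k \<subseteq> \<Union>K" using k by blast
  then show ?case using X by (intro exI[of _ X]) (simp add: subset_trans[OF X(3)])
next
  case (Basis s)
  then obtain x V where s: "s = {g \<in> fin_supp I. pairing g x \<in> V}" "x \<in> (\<Pi>\<^sub>E i\<in>I. UNIV)"
    by blast
  then show ?case using Basis.prems by (intro exI[of _ "{x}"]) auto
qed

lemma continuous_map_HI_pairing:
  assumes "x \<in> (\<Pi>\<^sub>E i\<in>I. UNIV)"
  shows "continuous_map (tg_top (HI I)) euclidean (\<lambda>g. pairing g x)"
  unfolding continuous_map_def using openin_HI_subbasis[OF assms] by simp

section \<open>Compact subsets of H are finite\<close>

text \<open>Gliding hump: if the supports of \<open>g \<in> K\<close> cover an infinite set, an \<open>x\<close> that is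
  unbounded on \<open>K\<close> is built coordinate by coordinate, each new coordinate lying outside the
  supports used so far and hence not disturbing the values already fixed.\<close>
lemma finite_if_pairings_finite:
  assumes K: "K \<subseteq> fin_supp I"
    and fin: "\<And>x. x \<in> (\<Pi>\<^sub>E i\<in>I. UNIV) \<Longrightarrow> finite ((\<lambda>g. pairing g x) ` K)"
  shows "finite K"
proof -
  define D where "D = (\<Union>g\<in>K. {i. g i \<noteq> 0})"
  have D_sub: "D \<subseteq> I" using K unfolding D_def fin_supp_def by blast
  have "finite D"
  proof (rule ccontr)
    assume inf: "infinite D"
    \<comment> \<open>A state is a finite set of coordinates already decided together with a vector
      carrying the decisions; \<open>Q\<close> forbids revising them and demands a \<open>g\<close>
      in \<open>K\<close> with large pairing whose support is decided entirely.\<close>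
    define P :: "nat \<Rightarrow> 'a set \<times> ('a \<Rightarrow> int) \<Rightarrow> bool" where "P n s \<longleftrightarrow> finite (fst s)" for n s
    define Q :: "nat \<Rightarrow> 'a set \<times> ('a \<Rightarrow> int) \<Rightarrow> 'a set \<times> ('a \<Rightarrow> int) \<Rightarrow> bool" where
      "Q n s s' \<longleftrightarrow> fst s \<subseteq> fst s' \<and> (\<forall>i\<in>fst s. snd s' i = snd s i) \<and>
        (\<exists>g\<in>K. {i. g i \<noteq> 0} \<subseteq> fst s' \<and> int n \<le> \<bar>pairing g (snd s')\<bar>)" for n s s'
    have step: "\<exists>s'. P (Suc n) s' \<and> Q n s s'" if Ps: "P n s" for n s
    proof -
      define F where "F = fst s"
      define y where "y = snd s"
      have F: "finite F" using Ps by (simp add: P_def F_def)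
      then have "\<not> D \<subseteq> F" using inf finite_subset by blast
      then obtain g j where g: "g \<in> K" "g j \<noteq> 0" "j \<notin> F" unfolding D_def by blast
      \<comment> \<open>The whole support of \<open>g\<close> is frozen, with 0 at its new
        coordinates other than \<open>j\<close>, so later stages cannot alter the pairing with
        \<open>g\<close>.\<close>
      define F' where "F' = F \<union> {i. g i \<noteq> 0}"
      define a where "a = (\<Sum>i\<in>F. g i * y i)"
      \<comment> \<open>As \<open>g j\<close> is a nonzero integer, |g j * v| is at least
        \<open>v\<close>; subtracting the old contribution \<open>a\<close> still leaves at least
        \<open>n\<close>.\<close>
      define v where "v = int n + \<bar>a\<bar>"
      define y' where "y' i = (if i \<in> F then y i else if i = j then v else 0)" for i
      have F': "finite F'" using F g(1) K by (auto simp: F'_def intro: finite_supp)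
      have "pairing g y' = (\<Sum>i\<in>F'. g i * y' i)" using F' by (rule pairing_eq_sum) (simp add: F'_def)
      also have "\<dots> = (\<Sum>i\<in>insert j F. g i * y' i)"
        by (rule sum.mono_neutral_right) (use F' g in \<open>auto simp: F'_def y'_def\<close>)
      also have "\<dots> = g j * v + (\<Sum>i\<in>F. g i * y' i)" using F g(3) by (simp add: y'_def)
      also have "(\<Sum>i\<in>F. g i * y' i) = a" unfolding a_def by (intro sum.cong) (simp_all add: y'_def)
      finally have "pairing g y' = g j * v + a" .
      moreover have "\<bar>g j * v\<bar> \<ge> v"
      proof -
        have "1 * v \<le> \<bar>g j\<bar> * v" using g(2) by (intro mult_right_mono) (auto simp: v_def)
        then show ?thesis by (simp add: abs_mult v_def)
      qed
      ultimately have "int n \<le> \<bar>pairing g y'\<bar>" unfolding v_def by linarith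
      then have "P (Suc n) (F', y') \<and> Q n s (F', y')"
        using F' g(1) by (auto simp: P_def Q_def F'_def F_def[symmetric] y_def[symmetric] y'_def)
      then show ?thesis by blast
    qed
    have "\<exists>x. P 0 x" by (rule exI[of _ "({}, \<lambda>_. 0)"]) (simp add: P_def)
    then obtain f where f: "\<And>n. P n (f n)" "\<And>n. Q n (f n) (f (Suc n))"
      using dependent_nat_choice[of P Q] step by metis
    have mono: "fst (f m) \<subseteq> fst (f n) \<and> (\<forall>i\<in>fst (f m). snd (f n) i = snd (f m) i)" if "m \<le> n" for m n
      using that
    proof (induction n rule: dec_induct)
      case (step n)
      have n: "fst (f n) \<subseteq> fst (f (Suc n))" "\<forall>i\<in>fst (f n). snd (f (Suc n)) i = snd (f n) i"
        using f(2)[of n] by (simp_all add: Q_def)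
      have "snd (f (Suc n)) i = snd (f m) i" if "i \<in> fst (f m)" for i
      proof -
        have "snd (f n) i = snd (f m) i" "i \<in> fst (f n)" using step.IH that by blast+
        then show ?thesis using n(2) by simp
      qed
      then show ?case using n(1) step.IH by blast
    qed simp
    \<comment> \<open>The limit of the stages: each coordinate is read at the first stage that
      decides it. Coordinates never decided receive an arbitrary value, harmless because the
      supports of the chosen \<open>g\<close> are all decided.\<close>
    define x where "x = (\<lambda>i\<in>I. snd (f (LEAST n. i \<in> fst (f n))) i)"
    have x_eq: "x i = snd (f n) i" if "i \<in> fst (f n)" "i \<in> I" for i n
    proof -
      have "i \<in> fst (f (LEAST n. i \<in> fst (f n)))" using that(1) by (rule LeastI)
      moreover have "(LEAST n. i \<in> fst (f n)) \<le> n" using that(1) by (rule Least_le)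
      ultimately have "snd (f n) i = snd (f (LEAST n. i \<in> fst (f n))) i" using mono by blast
      then show ?thesis using that(2) by (simp add: x_def)
    qed
    have x_mem: "x \<in> (\<Pi>\<^sub>E i\<in>I. UNIV)" by (simp add: x_def)
    have unbounded: "\<exists>g\<in>K. int n \<le> \<bar>pairing g x\<bar>" for n
    proof -
      obtain g where g: "g \<in> K" "{i. g i \<noteq> 0} \<subseteq> fst (f (Suc n))" "int n \<le> \<bar>pairing g (snd (f (Suc n)))\<bar>"
        using f(2)[of n] unfolding Q_def by (elim conjE bexE)
      have "pairing g x = pairing g (snd (f (Suc n)))"
        unfolding pairing_def
      proof (rule sum.cong)
        fix i assume "i \<in> {i. g i \<noteq> 0}"
        then have "i \<in> fst (f (Suc n))" "i \<in> I" using g K by (auto simp: fin_supp_def)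
        then show "g i * x i = g i * snd (f (Suc n)) i" using x_eq by simp
      qed simp
      then show ?thesis using g(1,3) by (intro bexI[of _ g]) simp_all
    qed
    have "finite (abs ` (\<lambda>g. pairing g x) ` K)" using fin[OF x_mem] by (rule finite_imageI)
    then have "bdd_above (abs ` (\<lambda>g. pairing g x) ` K)" by (rule bdd_above_finite)
    then obtain B where B: "\<forall>z\<in>abs ` (\<lambda>g. pairing g x) ` K. z \<le> B"
      unfolding bdd_above_def by (elim exE)
    obtain g where g: "g \<in> K" "int (nat (B + 1)) \<le> \<bar>pairing g x\<bar>"
      using unbounded[of "nat (B + 1)"] by (elim bexE)
    have "\<bar>pairing g x\<bar> \<le> B" using B g(1) by simp
    then show False using g(2) by linarith
  qed
  \<comment> \<open>An element of \<open>K\<close> is determined by its coordinates in the finite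
    set \<open>D\<close>, and each coordinate is a pairing with a unit vector, so it takes finitely
    many values on \<open>K\<close>.\<close>
  have "K \<subseteq> (\<lambda>h i. if i \<in> D then h i else 0) ` (\<Pi>\<^sub>E i\<in>D. (\<lambda>g. pairing g (unit_vec I i)) ` K)"
  proof
    fix g assume g: "g \<in> K"
    have gI: "g \<in> fin_supp I" using g K by blast
    show "g \<in> (\<lambda>h i. if i \<in> D then h i else 0) ` (\<Pi>\<^sub>E i\<in>D. (\<lambda>g. pairing g (unit_vec I i)) ` K)"
    proof (rule image_eqI)
      show "g = (\<lambda>i. if i \<in> D then (\<lambda>i\<in>D. pairing g (unit_vec I i)) i else 0)"
      proof
        fix i
        show "g i = (if i \<in> D then (\<lambda>i\<in>D. pairing g (unit_vec I i)) i else 0)"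
        proof (cases "i \<in> D")
          case True
          then show ?thesis using pairing_unit_vec[OF gI, of i] D_sub by auto
        next
          case False
          then show ?thesis using g by (auto simp: D_def)
        qed
      qed
      show "(\<lambda>i\<in>D. pairing g (unit_vec I i)) \<in> (\<Pi>\<^sub>E i\<in>D. (\<lambda>g. pairing g (unit_vec I i)) ` K)"
        using g by auto
    qed
  qed
  moreover have "finite (\<Pi>\<^sub>E i\<in>D. (\<lambda>g. pairing g (unit_vec I i)) ` K)"
    using \<open>finite D\<close> fin[OF unit_vec_mem] by (intro finite_PiE)
  ultimately show ?thesis using finite_subset by blast
qed

lemma compactin_int_imp_finite:
  fixes S :: "int set"
  assumes "compactin euclidean S"
  shows "finite S"
proof -
  have "compact S" using assms by simp
  then show ?thesis
  proof (rule compactE_image[where C = S and f = "\<lambda>z. {z}"])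
    fix C' assume "C' \<subseteq> S" "finite C'" "S \<subseteq> (\<Union>c\<in>C'. {c})"
    then show "finite S" by (simp add: finite_subset)
  qed (auto simp: open_discrete)
qed

lemma compactin_HI_imp_finite:
  assumes "compactin (tg_top (HI I)) K"
  shows "finite K"
proof (rule finite_if_pairings_finite)
  show "K \<subseteq> fin_supp I" using compactin_subset_topspace[OF assms] by simp
  fix x :: "'a \<Rightarrow> int" assume "x \<in> (\<Pi>\<^sub>E i\<in>I. UNIV)"
  then have "compactin euclidean ((\<lambda>g. pairing g x) ` K)"
    using image_compactin[OF assms continuous_map_HI_pairing] by blast
  then show "finite ((\<lambda>g. pairing g x) ` K)" by (rule compactin_int_imp_finite)
qed

section \<open>Characters of H\<close>

text \<open>Induction on \<open>X\<close>: on the common kernel \<open>K\<close> of the smaller set, the pairing with \<open>x\<close> has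
  image \<open>d\<int>\<close>, attained at \<open>k0\<close>, and \<open>ch k0 / d\<close> is the coefficient of \<open>x\<close>.\<close>
lemma sum_of_pairings_if_vanishing:
  assumes "finite X"
    and "\<And>g h. g \<in> fin_supp I \<Longrightarrow> h \<in> fin_supp I \<Longrightarrow> ch (\<lambda>i. g i + h i) - (ch g + ch h) \<in> \<int>"
    and "\<And>g. g \<in> fin_supp I \<Longrightarrow> (\<forall>x\<in>X. pairing g x = 0) \<Longrightarrow> ch g \<in> \<int>"
  shows "\<exists>t :: ('a \<Rightarrow> int) \<Rightarrow> real. \<forall>g\<in>fin_supp I. ch g - (\<Sum>x\<in>X. t x * of_int (pairing g x)) \<in> \<int>"
  using assms
proof (induction X arbitrary: ch rule: finite_induct)
  case empty
  then show ?case by simp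
next
  case (insert x X)
  define K where "K = {g \<in> fin_supp I. \<forall>y\<in>X. pairing g y = 0}"
  have K_add: "(\<lambda>i. g i + h i) \<in> K" if "g \<in> K" "h \<in> K" for g h
    using that by (simp add: K_def fin_supp_add pairing_add_left[of _ I])
  have K_mult: "(\<lambda>i. k * g i) \<in> K" if "g \<in> K" for g and k :: int
    using that by (simp add: K_def fin_supp_mult pairing_mult_left[of _ I])
  note ch_add = insert.prems(1)
  have ch_zero: "ch (\<lambda>i. 0) \<in> \<int>"
    using fin_supp_zero pairing_zero_left by (intro insert.prems(2)) auto
  have ch_Suc: "ch (\<lambda>i. (k + 1) * g i) - (ch (\<lambda>i. k * g i) + ch g) \<in> \<int>"
    if "g \<in> fin_supp I" for g and k :: int
    using ch_add[OF fin_supp_mult[OF that, of k] that] by (simp add: algebra_simps)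
  have ch_mult: "ch (\<lambda>i. k * g i) - of_int k * ch g \<in> \<int>" if g: "g \<in> fin_supp I" for g k
  proof (induction k rule: int_induct[where k = 0])
    case base
    then show ?case using ch_zero by simp
  next
    case (step1 k)
    have "ch (\<lambda>i. (k + 1) * g i) - of_int (k + 1) * ch g
      = (ch (\<lambda>i. (k + 1) * g i) - (ch (\<lambda>i. k * g i) + ch g)) + (ch (\<lambda>i. k * g i) - of_int k * ch g)"
      by (simp add: algebra_simps)
    then show ?case using Ints_add[OF ch_Suc[OF g, of k] step1.IH] by (simp only:)
  next
    case (step2 k)
    have "ch (\<lambda>i. (k - 1) * g i) - of_int (k - 1) * ch g
      = (ch (\<lambda>i. k * g i) - of_int k * ch g) - (ch (\<lambda>i. (k - 1 + 1) * g i) - (ch (\<lambda>i. (k - 1) * g i) + ch g))"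
      by (simp add: left_diff_distrib)
    then show ?case using Ints_diff[OF step2.IH ch_Suc[OF g, of "k - 1"]] by (simp only:)
  qed
  have "\<exists>s. \<forall>g\<in>K. ch g - s * of_int (pairing g x) \<in> \<int>"
  proof (cases "\<forall>g\<in>K. pairing g x = 0")
    case True
    then have "ch g \<in> \<int>" if "g \<in> K" for g using that by (intro insert.prems(2)) (auto simp: K_def)
    then show ?thesis by (intro exI[of _ 0]) simp
  next
    case False
    define m where "m g = nat \<bar>pairing g x\<bar>" for g
    \<comment> \<open>A least nonzero absolute value of the pairing on \<open>K\<close>; the
      division remainder \<open>r\<close> built below also lies in \<open>K\<close> and would
      undercut it unless its pairing is zero.\<close>
    obtain k0 where k0: "k0 \<in> K \<and> pairing k0 x \<noteq> 0"
      "\<forall>g. g \<in> K \<and> pairing g x \<noteq> 0 \<longrightarrow> m k0 \<le> m g"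
      using ex_has_least_nat[of "\<lambda>g. g \<in> K \<and> pairing g x \<noteq> 0" _ m] False by blast
    define d where "d = pairing k0 x"
    have d: "d \<noteq> 0" using k0 by (simp add: d_def)
    have k0K: "k0 \<in> K" "k0 \<in> fin_supp I" using k0 by (auto simp: K_def)
    have "ch g - ch k0 / of_int d * of_int (pairing g x) \<in> \<int>" if g: "g \<in> K" for g
    proof -
      define q where "q = pairing g x div d"
      define r where "r = (\<lambda>i. g i + - q * k0 i)"
      have gI: "g \<in> fin_supp I" using g by (simp add: K_def)
      have rK: "r \<in> K" unfolding r_def using K_add[OF g K_mult[OF k0K(1), of "- q"]] .
      have "pairing r x = pairing g x + - q * d"
        unfolding r_def d_def using pairing_add_left[OF gI fin_supp_mult[OF k0K(2), of "- q"], of x]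
          pairing_mult_left[OF k0K(2), of "- q" x] by simp
      also have "\<dots> = pairing g x mod d" unfolding q_def by (simp add: minus_mult_div_eq_mod[symmetric] mult.commute)
      finally have r_mod: "pairing r x = pairing g x mod d" .
      have "\<bar>pairing r x\<bar> < \<bar>d\<bar>" unfolding r_mod using d by (rule abs_mod_less)
      then have "m r < m k0" unfolding m_def d_def by linarith
      then have r0: "pairing r x = 0" using k0(2) rK not_le by blast
      have 1: "ch r \<in> \<int>" using r0 rK by (intro insert.prems(2)) (auto simp: K_def)
      have 2: "ch r - (ch g + ch (\<lambda>i. - q * k0 i)) \<in> \<int>"
        unfolding r_def using ch_add[OF gI fin_supp_mult[OF k0K(2)]] .
      have "ch r - (ch r - (ch g + ch (\<lambda>i. - q * k0 i)))
          - (ch (\<lambda>i. - q * k0 i) - of_int (- q) * ch k0) \<in> \<int>"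
        by (rule Ints_diff[OF Ints_diff[OF 1 2] ch_mult[OF k0K(2)]])
      then have "ch g - of_int q * ch k0 \<in> \<int>" by simp
      moreover have "pairing g x = q * d" using r0 r_mod unfolding q_def by auto
      ultimately show ?thesis using d by (simp add: mult.commute)
    qed
    then show ?thesis by blast
  qed
  then obtain s where s: "\<forall>g\<in>K. ch g - s * of_int (pairing g x) \<in> \<int>" by blast
  \<comment> \<open>After subtraction the values are integers on all of \<open>K\<close>, which is
    the hypothesis for the smaller set. The new function is real-valued and additive only modulo
    integers, whence the form of the assumptions on \<open>ch\<close>.\<close>
  define ch' where "ch' g = ch g - s * of_int (pairing g x)" for g
  have "\<exists>t. \<forall>g\<in>fin_supp I. ch' g - (\<Sum>y\<in>X. t y * of_int (pairing g y)) \<in> \<int>"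
  proof (rule insert.IH)
    fix g h assume gh: "g \<in> fin_supp I" "h \<in> fin_supp I"
    have "ch' (\<lambda>i. g i + h i) - (ch' g + ch' h) = ch (\<lambda>i. g i + h i) - (ch g + ch h)"
      by (simp add: ch'_def pairing_add_left[OF gh] algebra_simps)
    then show "ch' (\<lambda>i. g i + h i) - (ch' g + ch' h) \<in> \<int>" using ch_add[OF gh] by (simp only:)
  next
    fix g assume "g \<in> fin_supp I" "\<forall>y\<in>X. pairing g y = 0"
    then have "g \<in> K" by (simp add: K_def)
    then show "ch' g \<in> \<int>" using s by (simp add: ch'_def)
  qed
  then obtain t where t: "\<forall>g\<in>fin_supp I. ch' g - (\<Sum>y\<in>X. t y * of_int (pairing g y)) \<in> \<int>" by blast
  have "(\<Sum>y\<in>insert x X. (t(x := s)) y * of_int (pairing g y))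
      = s * of_int (pairing g x) + (\<Sum>y\<in>X. t y * of_int (pairing g y))" for g
  proof -
    have "(\<Sum>y\<in>X. (t(x := s)) y * of_int (pairing g y)) = (\<Sum>y\<in>X. t y * of_int (pairing g y))"
      using insert.hyps(2) by (intro sum.cong) auto
    then show ?thesis using insert.hyps by simp
  qed
  then have "\<forall>g\<in>fin_supp I. ch g - (\<Sum>y\<in>insert x X. (t(x := s)) y * of_int (pairing g y)) \<in> \<int>"
    using t by (simp only: ch'_def) (simp add: algebra_simps)
  then show ?case by (intro exI[of _ "t(x := s)"])
qed

text \<open>Continuity at zero bounds \<open>z\<close> by 1/4 on the common kernel of finitely many
  pairings. The kernel is closed under multiples, so \<open>z\<close> vanishes on it, and
  \<open>sum_of_pairings_if_vanishing\<close> supplies the coefficients.\<close>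

lemma character_HI_eq_sum:
  assumes "character (HI I) z"
  shows "\<exists>X t. finite X \<and> X \<subseteq> (\<Pi>\<^sub>E i\<in>I. UNIV) \<and>
    (\<forall>g\<in>fin_supp I. z g = frac (\<Sum>x\<in>X. t x * of_int (pairing g x)))"
proof -
  have add: "z (\<lambda>i. g i + h i) - (z g + z h) \<in> \<int>" if "g \<in> fin_supp I" "h \<in> fin_supp I" for g h
    using character_add_Ints[OF assms, of g h] that by simp
  have z0: "z (\<lambda>i. 0) = 0"
    using character_add[OF assms, of "\<lambda>i. 0" "\<lambda>i. 0"] character_mem[OF assms, of "\<lambda>i. 0"] fin_supp_zero[of I]
    by (intro frac_sum_zero) auto
  define N where "N = {g \<in> topspace (tg_top (HI I)). tnorm (z g - 0) < 1/4}"
  have "openin (tg_top (HI I)) N"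
    unfolding N_def by (intro openin_TT_preimage_ball character_cont assms) auto
  moreover have "(\<lambda>i. 0) \<in> N" using z0 fin_supp_zero by (simp add: N_def)
  ultimately obtain X where X: "finite X" "X \<subseteq> (\<Pi>\<^sub>E i\<in>I. UNIV)"
      "{h \<in> fin_supp I. \<forall>x\<in>X. pairing h x = pairing (\<lambda>i. 0) x} \<subseteq> N"
    using openin_HI_near[of I N "\<lambda>i. 0"] by blast
  have "z g \<in> \<int>" if g: "g \<in> fin_supp I" "\<forall>x\<in>X. pairing g x = 0" for g
  proof (rule tnorm_bounded_multiples)
    fix k :: nat
    have "z (\<lambda>i. int k * g i) - real k * z g \<in> \<int>"
    proof (induction k)
      case 0
      then show ?case using z0 by simp
    next
      case (Suc k)
      have "(\<lambda>i. int (Suc k) * g i) = (\<lambda>i. int k * g i + g i)" by (simp add: algebra_simps)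
      then have "z (\<lambda>i. int (Suc k) * g i) - real (Suc k) * z g
        = (z (\<lambda>i. int k * g i + g i) - (z (\<lambda>i. int k * g i) + z g)) + (z (\<lambda>i. int k * g i) - real k * z g)"
        by (simp add: algebra_simps)
      then show ?case using Ints_add[OF add[OF fin_supp_mult[OF g(1)] g(1)] Suc] by (simp only:)
    qed
    then have "tnorm (real k * z g) = tnorm (z (\<lambda>i. int k * g i))"
      using tnorm_cong by (metis tnorm_minus minus_diff_eq)
    moreover have "(\<lambda>i. int k * g i) \<in> N"
    proof (rule subsetD[OF X(3)])
      show "(\<lambda>i. int k * g i) \<in> {h \<in> fin_supp I. \<forall>x\<in>X. pairing h x = pairing (\<lambda>i. 0) x}"
        using fin_supp_mult[OF g(1), of "int k"] g(2)
        by (simp add: pairing_mult_left[OF g(1)] pairing_zero_left)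
    qed
    ultimately show "tnorm (real k * z g) \<le> 1/4" by (simp add: N_def)
  qed
  then have "\<exists>t. \<forall>g\<in>fin_supp I. z g - (\<Sum>x\<in>X. t x * of_int (pairing g x)) \<in> \<int>"
    by (intro sum_of_pairings_if_vanishing[where ch = z] X(1) add)
  then obtain t where t: "\<forall>g\<in>fin_supp I. z g - (\<Sum>x\<in>X. t x * of_int (pairing g x)) \<in> \<int>"
    by (elim exE)
  have "z g = frac (\<Sum>x\<in>X. t x * of_int (pairing g x))" if g: "g \<in> fin_supp I" for g
    using t[rule_format, OF g] character_mem[OF assms, of g] g frac_eq_id[of "z g"]
    by (simp add: frac_eq_iff[symmetric])
  then show ?thesis using X by (intro exI[of _ X] exI[of _ t]) simp
qed

section \<open>The dual group\<close>

lemma dual_sel [simp]: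
  "tg_carrier (dual G) = {ch. character G ch \<and> ch \<in> extensional (tg_carrier G)}"
  "tg_add (dual G) z w = (\<lambda>g\<in>tg_carrier G. frac (z g + w g))"
  "tg_zero (dual G) = (\<lambda>g\<in>tg_carrier G. 0)"
  "tg_neg (dual G) z = (\<lambda>g\<in>tg_carrier G. frac (- z g))"
  by (simp_all add: dual_def)

lemma top_dual:
  "tg_top (dual G) = topology_generated_by
     {{ch. character G ch \<and> ch \<in> extensional (tg_carrier G) \<and> ch ` K \<subseteq> U} | K U.
       compactin (tg_top G) K \<and> openin (tg_top TT) U}"
  by (simp add: dual_def)

lemma openin_dual_subbasis:
  assumes "compactin (tg_top G) K" "openin (tg_top TT) U"
  shows "openin (tg_top (dual G)) {ch. character G ch \<and> ch \<in> extensional (tg_carrier G) \<and> ch ` K \<subseteq> U}"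
  unfolding top_dual using assms by (intro topology_generated_by_Basis) blast

lemma topspace_dual: "topspace (tg_top (dual G)) = tg_carrier (dual G)"
proof
  show "topspace (tg_top (dual G)) \<subseteq> tg_carrier (dual G)"
    unfolding top_dual topology_generated_by_topspace by auto
  have "openin (tg_top (dual G)) {ch. character G ch \<and> ch \<in> extensional (tg_carrier G) \<and> ch ` {} \<subseteq> {}}"
    by (rule openin_dual_subbasis) auto
  then show "tg_carrier (dual G) \<subseteq> topspace (tg_top (dual G))"
    using openin_subset by fastforce
qed

lemma continuous_map_dual_eval:
  assumes "g \<in> topspace (tg_top G)"
  shows "continuous_map (tg_top (dual G)) (tg_top TT) (\<lambda>z. z g)"
  unfolding continuous_map_def
proof (intro conjI allI impI)
  fix U assume U: "openin (tg_top TT) U"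
  have "openin (tg_top (dual G)) {ch. character G ch \<and> ch \<in> extensional (tg_carrier G) \<and> ch ` {g} \<subseteq> U}"
    using assms U by (intro openin_dual_subbasis) simp_all
  also have "{ch. character G ch \<and> ch \<in> extensional (tg_carrier G) \<and> ch ` {g} \<subseteq> U}
    = {z \<in> topspace (tg_top (dual G)). z g \<in> U}" by (auto simp: topspace_dual)
  finally show "openin (tg_top (dual G)) {z \<in> topspace (tg_top (dual G)). z g \<in> U}" .
next
  show "(\<lambda>z. z g) \<in> topspace (tg_top (dual G)) \<rightarrow> topspace (tg_top TT)"
    using continuous_map_funspace[OF character_cont] assms by (auto simp: topspace_dual Pi_iff)
qed

text \<open>The compact sets testing the compact-open topology are finite here, so a subbasic
  preimage is a finite intersection of preimages under evaluations.\<close>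

lemma continuous_map_into_dual_HI:
  assumes f: "f \<in> topspace X \<rightarrow> tg_carrier (dual (HI I))"
    and ev: "\<And>g. g \<in> fin_supp I \<Longrightarrow> continuous_map X (tg_top TT) (\<lambda>x. f x g)"
  shows "continuous_map X (tg_top (dual (HI I))) f"
  unfolding top_dual
proof (rule continuous_on_generated_topo)
  fix B assume "B \<in> {{ch. character (HI I) ch \<and> ch \<in> extensional (tg_carrier (HI I)) \<and> ch ` K \<subseteq> U} | K U.
       compactin (tg_top (HI I)) K \<and> openin (tg_top TT) U}"
  then obtain K U where KU: "compactin (tg_top (HI I)) K" "openin (tg_top TT) U"
    and B: "B = {ch. character (HI I) ch \<and> ch \<in> extensional (tg_carrier (HI I)) \<and> ch ` K \<subseteq> U}" by blast
  have K: "finite K" "K \<subseteq> fin_supp I"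
    using compactin_HI_imp_finite[OF KU(1)] compactin_subset_topspace[OF KU(1)] by simp_all
  have "openin X ((\<Inter>g\<in>K. {x \<in> topspace X. f x g \<in> U}) \<inter> topspace X)"
    using K KU(2) by (intro openin_INT openin_continuous_map_preimage[OF ev]) auto
  also have "(\<Inter>g\<in>K. {x \<in> topspace X. f x g \<in> U}) \<inter> topspace X = f -` B \<inter> topspace X"
    using f unfolding B by (auto simp: Pi_iff)
  finally show "openin X (f -` B \<inter> topspace X)" .
next
  have "f ` topspace X \<subseteq> topspace (tg_top (dual (HI I)))"
    using f unfolding topspace_dual by blast
  then show "f ` topspace X \<subseteq> \<Union>{{ch. character (HI I) ch \<and> ch \<in> extensional (tg_carrier (HI I)) \<and> ch ` K \<subseteq> U} | K U.
       compactin (tg_top (HI I)) K \<and> openin (tg_top TT) U}"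
    unfolding top_dual topology_generated_by_topspace .
qed

lemma restrict_character_mem_dual:
  assumes "character (HI I) f"
  shows "(\<lambda>g\<in>fin_supp I. f g) \<in> tg_carrier (dual (HI I))"
proof -
  have "continuous_map (tg_top (HI I)) (tg_top TT) (\<lambda>g\<in>fin_supp I. f g)"
    using character_cont[OF assms] by (rule continuous_map_eq) simp
  then have "character (HI I) (\<lambda>g\<in>fin_supp I. f g)"
    using assms unfolding character_def cont_hom_def by (simp add: fin_supp_add)
  then show ?thesis by simp
qed

lemma character_sum:
  assumes "character G f" "character G h"
  shows "character G (\<lambda>x. frac (f x + h x))"
  unfolding character_def cont_hom_def
proof (intro conjI ballI)
  show "continuous_map (tg_top G) (tg_top TT) (\<lambda>x. frac (f x + h x))"
    by (intro continuous_map_TT_add character_cont assms)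
  fix x y assume xy: "x \<in> tg_carrier G" "y \<in> tg_carrier G"
  have "frac (f (tg_add G x y) + h (tg_add G x y)) = frac ((f x + f y) + (h x + h y))"
    unfolding character_add[OF assms(1) xy] character_add[OF assms(2) xy]
    by (simp only: frac_add_simps)
  also have "(f x + f y) + (h x + h y) = (f x + h x) + (f y + h y)" by simp
  finally show "frac (f (tg_add G x y) + h (tg_add G x y)) = tg_add TT (frac (f x + h x)) (frac (f y + h y))"
    by (simp only: TT_sel frac_add_simps)
qed (simp add: frac_lt_1)

lemma top_ab_group_dual_HI: "top_ab_group (dual (HI I))"
  unfolding top_ab_group_def
proof (intro conjI ballI)
  let ?D = "dual (HI I)"
  show "topspace (tg_top ?D) = tg_carrier ?D" by (rule topspace_dual)
  have "character (HI I) (\<lambda>g. 0)"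
    unfolding character_def cont_hom_def by (simp add: top_TT)
  then show "tg_zero ?D \<in> tg_carrier ?D"
    using restrict_character_mem_dual[of I "\<lambda>g. 0"] by (simp only: dual_sel HI_sel)
  fix z assume z: "z \<in> tg_carrier ?D"
  have z_mem: "frac (z g) = z g" if "g \<in> fin_supp I" for g
    using z that character_mem[of "HI I" z g] frac_eq_id[of "z g"] by simp
  show "tg_neg ?D z \<in> tg_carrier ?D"
    using restrict_character_mem_dual[OF character_int_mult[of "HI I" z "-1"]] z by simp
  show "tg_add ?D z (tg_zero ?D) = z"
  proof (rule extensionalityI[of _ "fin_supp I"])
    show "z \<in> extensional (fin_supp I)" using z by simp
  qed (simp_all add: z_mem)
  show "tg_add ?D z (tg_neg ?D z) = tg_zero ?D"
    unfolding dual_sel HI_sel by (rule restrict_ext) simp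
  fix w assume w: "w \<in> tg_carrier ?D"
  show "tg_add ?D z w \<in> tg_carrier ?D"
    using restrict_character_mem_dual[OF character_sum[of "HI I" z w]] z w by simp
  show "tg_add ?D z w = tg_add ?D w z" unfolding dual_sel by (simp only: add.commute)
  fix u assume "u \<in> tg_carrier ?D"
  show "tg_add ?D (tg_add ?D z w) u = tg_add ?D z (tg_add ?D w u)"
    unfolding dual_sel HI_sel by (rule restrict_ext) (simp add: add.assoc)
next
  let ?D = "dual (HI I)"
  have add_mem: "tg_add ?D z w \<in> tg_carrier ?D" if "z \<in> tg_carrier ?D" "w \<in> tg_carrier ?D" for z w
    using restrict_character_mem_dual[OF character_sum[of "HI I" z w]] that by simp
  have ev: "continuous_map (tg_top ?D) (tg_top TT) (\<lambda>z. z g)" if "g \<in> fin_supp I" for g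
    using that by (intro continuous_map_dual_eval) simp
  show "continuous_map (prod_topology (tg_top ?D) (tg_top ?D)) (tg_top ?D) (\<lambda>(x, y). tg_add ?D x y)"
  proof (rule continuous_map_into_dual_HI)
    show "(\<lambda>(x, y). tg_add ?D x y) \<in> topspace (prod_topology (tg_top ?D) (tg_top ?D)) \<rightarrow> tg_carrier ?D"
      unfolding topspace_prod_topology topspace_dual
    proof (rule Pi_I)
      fix p assume p: "p \<in> tg_carrier ?D \<times> tg_carrier ?D"
      show "(case p of (x, y) \<Rightarrow> tg_add ?D x y) \<in> tg_carrier ?D"
        unfolding case_prod_unfold using p by (intro add_mem) (simp_all only: mem_Times_iff)
    qed
    fix g assume g: "g \<in> fin_supp I"
    have "continuous_map (prod_topology (tg_top ?D) (tg_top ?D)) (tg_top TT) (\<lambda>p. frac (fst p g + snd p g))"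
      using continuous_map_compose[OF continuous_map_fst ev[OF g]]
        continuous_map_compose[OF continuous_map_snd ev[OF g]]
      unfolding o_def by (rule continuous_map_TT_add)
    then show "continuous_map (prod_topology (tg_top ?D) (tg_top ?D)) (tg_top TT)
        (\<lambda>p. (case p of (x, y) \<Rightarrow> tg_add ?D x y) g)"
      using g by (simp add: case_prod_unfold)
  qed
  show "continuous_map (tg_top ?D) (tg_top ?D) (tg_neg ?D)"
  proof (rule continuous_map_into_dual_HI)
    have "tg_neg ?D z \<in> tg_carrier ?D" if "z \<in> tg_carrier ?D" for z
      using restrict_character_mem_dual[OF character_int_mult[of "HI I" z "-1"]] that by simp
    then show "tg_neg ?D \<in> topspace (tg_top ?D) \<rightarrow> tg_carrier ?D"
      unfolding topspace_dual by (rule Pi_I)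
    fix g assume g: "g \<in> fin_supp I"
    show "continuous_map (tg_top ?D) (tg_top TT) (\<lambda>z. tg_neg ?D z g)"
      using continuous_map_TT_int_mult[OF ev[OF g], of "-1"] g by simp
  qed
qed

lemma Hausdorff_dual_HI: "Hausdorff_space (tg_top (dual (HI I)))"
  unfolding Hausdorff_space_def
proof (intro allI impI)
  fix z w assume "z \<in> topspace (tg_top (dual (HI I))) \<and> w \<in> topspace (tg_top (dual (HI I))) \<and> z \<noteq> w"
  then have zw: "z \<in> tg_carrier (dual (HI I))" "w \<in> tg_carrier (dual (HI I))" "z \<noteq> w"
    by (simp_all add: topspace_dual)
  then obtain g where g: "g \<in> fin_supp I" "z g \<noteq> w g"
    using extensionalityI[of z "fin_supp I" w] by auto
  have mem: "z g \<in> topspace (tg_top TT)" "w g \<in> topspace (tg_top TT)"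
    using zw character_mem[of "HI I" z g] character_mem[of "HI I" w g] g(1) by (simp_all add: top_TT)
  have "Hausdorff_space (tg_top TT)" using in_Q_TT by (simp add: in_Q_def)
  then obtain U V where UV: "openin (tg_top TT) U" "openin (tg_top TT) V" "z g \<in> U" "w g \<in> V" "disjnt U V"
    using mem g(2) unfolding Hausdorff_space_def by blast
  let ?p = "\<lambda>U. {z \<in> topspace (tg_top (dual (HI I))). z g \<in> U}"
  have ev: "continuous_map (tg_top (dual (HI I))) (tg_top TT) (\<lambda>z. z g)"
    using g(1) by (intro continuous_map_dual_eval) simp
  show "\<exists>U V. openin (tg_top (dual (HI I))) U \<and> openin (tg_top (dual (HI I))) V \<and> z \<in> U \<and> w \<in> V \<and> disjnt U V"
  proof (intro exI conjI)
    show "openin (tg_top (dual (HI I))) (?p U)" "openin (tg_top (dual (HI I))) (?p V)"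
      using UV openin_continuous_map_preimage[OF ev] by blast+
    show "z \<in> ?p U" "w \<in> ?p V" using zw UV unfolding topspace_dual by blast+
    show "disjnt (?p U) (?p V)" using UV(5) by (auto simp: disjnt_iff)
  qed
qed

text \<open>For a subbasic set the test set \<open>K\<close> is finite, so a single radius serves
  all of its points; this turns the compact-open topology into explicit estimates at finitely many
  elements of H.\<close>

lemma openin_dual_HI_near:
  assumes "openin (tg_top (dual (HI I))) U" "z \<in> U"
  shows "\<exists>S e. finite S \<and> S \<subseteq> fin_supp I \<and> e > 0 \<and>
    {w \<in> tg_carrier (dual (HI I)). \<forall>g\<in>S. tnorm (w g - z g) < e} \<subseteq> U"
  using assms(1)[unfolded top_dual, THEN openin_topology_generated_by] assms(2)
proof (induction U rule: generate_topology_on.induct)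
  case Empty
  then show ?case by simp
next
  case (Int a b)
  have ab: "z \<in> a" "z \<in> b" using Int.prems by simp_all
  obtain S d where S: "finite S" "S \<subseteq> fin_supp I" "d > 0"
      "{w \<in> tg_carrier (dual (HI I)). \<forall>g\<in>S. tnorm (w g - z g) < d} \<subseteq> a"
    using Int.IH(1)[OF ab(1)] by (elim exE conjE)
  obtain S' e where S': "finite S'" "S' \<subseteq> fin_supp I" "e > 0"
      "{w \<in> tg_carrier (dual (HI I)). \<forall>g\<in>S'. tnorm (w g - z g) < e} \<subseteq> b"
    using Int.IH(2)[OF ab(2)] by (elim exE conjE)
  show ?case
  proof (intro exI conjI)
    show "finite (S \<union> S')" using S(1) S'(1) by simp
    show "S \<union> S' \<subseteq> fin_supp I" using S(2) S'(2) by simp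
    show "min d e > 0" using S(3) S'(3) by simp
    show "{w \<in> tg_carrier (dual (HI I)). \<forall>g\<in>S \<union> S'. tnorm (w g - z g) < min d e} \<subseteq> a \<inter> b"
    proof
      fix w assume "w \<in> {w \<in> tg_carrier (dual (HI I)). \<forall>g\<in>S \<union> S'. tnorm (w g - z g) < min d e}"
      then have "w \<in> {w \<in> tg_carrier (dual (HI I)). \<forall>g\<in>S. tnorm (w g - z g) < d}"
        "w \<in> {w \<in> tg_carrier (dual (HI I)). \<forall>g\<in>S'. tnorm (w g - z g) < e}" by simp_all
      then show "w \<in> a \<inter> b" using S(4) S'(4) by blast
    qed
  qed
next
  case (UN K)
  then obtain k where k: "k \<in> K" "z \<in> k" by blast
  obtain S e where S: "finite S" "S \<subseteq> fin_supp I" "e > 0"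
      "{w \<in> tg_carrier (dual (HI I)). \<forall>g\<in>S. tnorm (w g - z g) < e} \<subseteq> k"
    using UN.IH[OF k] by (elim exE conjE)
  have "k \<subseteq> \<Union>K" using k by blast
  then show ?case using S(1-3) subset_trans[OF S(4)] by (intro exI[of _ S] exI[of _ e] conjI)
next
  case (Basis s)
  then obtain K V where KV: "compactin (tg_top (HI I)) K" "openin (tg_top TT) V"
    and s: "s = {ch. character (HI I) ch \<and> ch \<in> extensional (tg_carrier (HI I)) \<and> ch ` K \<subseteq> V}" by blast
  have K: "finite K" "K \<subseteq> fin_supp I"
    using compactin_HI_imp_finite[OF KV(1)] compactin_subset_topspace[OF KV(1)] by simp_all
  have zK: "z ` K \<subseteq> V" "character (HI I) z" using Basis.prems s by simp_all
  have "\<exists>e>0. \<forall>g\<in>K. circle.mball (z g) e \<subseteq> V"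
    using K(1) zK(1)
  proof (induction K rule: finite_induct)
    case empty
    then show ?case by (intro exI[of _ 1]) simp
  next
    case (insert g K)
    obtain e where e: "e > 0" "\<forall>g\<in>K. circle.mball (z g) e \<subseteq> V"
      using insert.IH insert.prems by auto
    obtain d where d: "d > 0" "circle.mball (z g) d \<subseteq> V"
      using KV(2) insert.prems unfolding top_TT circle.openin_mtopology by auto
    have "circle.mball (z h) (min d e) \<subseteq> V" if "h \<in> insert g K" for h
    proof (cases "h = g")
      case True
      then show ?thesis using d(2) circle.mball_subset_concentric[of "min d e" d "z g"] by simp
    next
      case False
      then have "circle.mball (z h) e \<subseteq> V" using e(2) that by blast
      then show ?thesis using circle.mball_subset_concentric[of "min d e" e "z h"] by simp
    qed
    then show ?case using d(1) e(1) by (intro exI[of _ "min d e"]) simp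
  qed
  then obtain e where e: "e > 0" "\<forall>g\<in>K. circle.mball (z g) e \<subseteq> V" by (elim exE conjE)
  have "{w \<in> tg_carrier (dual (HI I)). \<forall>g\<in>K. tnorm (w g - z g) < e} \<subseteq> s"
  proof
    fix w assume w: "w \<in> {w \<in> tg_carrier (dual (HI I)). \<forall>g\<in>K. tnorm (w g - z g) < e}"
    have "w g \<in> V" if g: "g \<in> K" for g
    proof -
      have "w g \<in> circle.mball (z g) e"
        using w g K(2) zK(2) character_mem[of "HI I" z g] character_mem[of "HI I" w g]
          circle.commute[of "z g" "w g"] by auto
      then show ?thesis using e(2) g by blast
    qed
    then show "w \<in> s" using w s by auto
  qed
  then show ?case using K e(1) by (intro exI[of _ K] exI[of _ e] conjI)
qed

lemma character_dual_HI_eval: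
  assumes "g \<in> fin_supp I"
  shows "character (dual (HI I)) (\<lambda>z. z g)"
  unfolding character_def cont_hom_def
proof (intro conjI ballI)
  show "continuous_map (tg_top (dual (HI I))) (tg_top TT) (\<lambda>z. z g)"
    using assms by (intro continuous_map_dual_eval) simp
  fix z assume "z \<in> tg_carrier (dual (HI I))"
  then show "z g \<in> tg_carrier TT" using assms character_mem[of "HI I" z g] by simp
qed (use assms in simp)

text \<open>Evaluations at elements of H are characters of the dual, and finitely many of them
  control any neighbourhood of zero, as \<open>in_Q_weak\<close> requires.\<close>

lemma in_Q_dual_HI: "in_Q (dual (HI I))"
proof (rule in_Q_weak[OF top_ab_group_dual_HI Hausdorff_dual_HI])
  fix U assume U: "openin (tg_top (dual (HI I))) U" "tg_zero (dual (HI I)) \<in> U"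
  obtain S e where S: "finite S" "S \<subseteq> fin_supp I" "e > 0"
      "{w \<in> tg_carrier (dual (HI I)). \<forall>g\<in>S. tnorm (w g - tg_zero (dual (HI I)) g) < e} \<subseteq> U"
    using openin_dual_HI_near[OF U] by (elim exE conjE)
  have "{w \<in> tg_carrier (dual (HI I)). \<forall>ch\<in>(\<lambda>g z. z g) ` S. tnorm (ch w) < e} \<subseteq> U"
  proof
    fix w assume w: "w \<in> {w \<in> tg_carrier (dual (HI I)). \<forall>ch\<in>(\<lambda>g z. z g) ` S. tnorm (ch w) < e}"
    have "w \<in> {w \<in> tg_carrier (dual (HI I)). \<forall>g\<in>S. tnorm (w g - tg_zero (dual (HI I)) g) < e}"
      using w S(2) by auto
    then show "w \<in> U" using S(4) by blast
  qed
  then show "\<exists>S e. finite S \<and> e > 0 \<and> (\<forall>ch\<in>S. character (dual (HI I)) ch) \<and>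
        {x \<in> tg_carrier (dual (HI I)). \<forall>ch\<in>S. tnorm (ch x) < e} \<subseteq> U"
    using S(1,3) subsetD[OF S(2)] character_dual_HI_eval
    by (intro exI[of _ "(\<lambda>g z. z g) ` S"] exI[of _ e] conjI) auto
qed

section \<open>The canonical bihomomorphism and generation of the dual\<close>

lemma canon_bihom_mem:
  assumes x: "x \<in> (\<Pi>\<^sub>E i\<in>I. UNIV)"
  shows "canon_bihom I x t \<in> tg_carrier (dual (HI I))"
  unfolding canon_bihom_def
proof (rule restrict_character_mem_dual)
  show "character (HI I) (\<lambda>g. frac (t * of_int (pairing g x)))"
    unfolding character_def cont_hom_def
    using continuous_map_TT_mult_int[OF continuous_map_HI_pairing[OF x], of t]
    by (simp add: frac_lt_1 pairing_add_left[of _ I] distrib_left)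
qed

text \<open>The description of characters as finite sums of pairings says that the canonical
  elements generate the dual. In this form it yields both the existence of values for the
  factorization and its uniqueness.\<close>

lemma dual_HI_induct [consumes 1, case_names canon add]:
  assumes z: "z \<in> tg_carrier (dual (HI I))"
    and canon: "\<And>x t. x \<in> (\<Pi>\<^sub>E i\<in>I. UNIV) \<Longrightarrow> t \<in> {0..<1} \<Longrightarrow> P (canon_bihom I x t)"
    and add: "\<And>u v. u \<in> tg_carrier (dual (HI I)) \<Longrightarrow> v \<in> tg_carrier (dual (HI I)) \<Longrightarrow> P u \<Longrightarrow> P v \<Longrightarrow>
      P (tg_add (dual (HI I)) u v)"
  shows "P z"
proof -
  obtain X t where X: "finite X" "X \<subseteq> (\<Pi>\<^sub>E i\<in>I. UNIV)"
      "\<forall>g\<in>fin_supp I. z g = frac (\<Sum>x\<in>X. t x * of_int (pairing g x))"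
    using character_HI_eq_sum[of I z] z by auto
  define s where "s Y = (\<lambda>g\<in>fin_supp I. frac (\<Sum>x\<in>Y. t x * of_int (pairing g x)))" for Y
  have "s Y \<in> tg_carrier (dual (HI I)) \<and> P (s Y)" if "finite Y" "Y \<subseteq> X" for Y
    using that
  proof (induction Y rule: finite_induct)
    case empty
    have zero: "(\<lambda>i\<in>I. 0) \<in> (\<Pi>\<^sub>E i\<in>I. UNIV)" by simp
    \<comment> \<open>The zero character is itself canonical, so the induction rule has no separate
      case for it.\<close>
    have "s {} = canon_bihom I (\<lambda>i\<in>I. 0) 0" by (simp add: s_def canon_bihom_def)
    then show ?case using canon_bihom_mem[OF zero, of 0] canon[OF zero, of 0] by simp
  next
    case (insert x Y)
    have x: "x \<in> (\<Pi>\<^sub>E i\<in>I. UNIV)" using insert.prems X(2) by blast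
    have IH: "s Y \<in> tg_carrier (dual (HI I))" "P (s Y)" using insert.IH insert.prems by blast+
    \<comment> \<open>Coefficients must be reduced into [0,1) to be points of the circle; multiplied
      by an integer, the reduction changes the sum only by an integer.\<close>
    have fr: "frac (frac (t x) * of_int k + r) = frac (t x * of_int k + r)" for k r
    proof -
      have "frac (t x) * of_int k + r - (t x * of_int k + r) = (frac (t x) - t x) * of_int k"
        by (simp add: algebra_simps)
      also have "\<dots> \<in> \<int>" by (intro Ints_mult frac_diff_Ints Ints_of_int)
      finally show ?thesis unfolding frac_eq_iff .
    qed
    have eq: "s (insert x Y) = tg_add (dual (HI I)) (canon_bihom I x (frac (t x))) (s Y)"
      unfolding s_def canon_bihom_def dual_sel HI_sel
      by (rule restrict_ext) (simp add: insert.hyps fr)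
    have mem: "canon_bihom I x (frac (t x)) \<in> tg_carrier (dual (HI I))" by (rule canon_bihom_mem[OF x])
    have "P (s (insert x Y))" unfolding eq
      by (rule add[OF mem IH(1) canon[OF x frac_mem] IH(2)])
    moreover have "s (insert x Y) \<in> tg_carrier (dual (HI I))"
      unfolding eq using top_ab_group_dual_HI mem IH(1) unfolding top_ab_group_def by blast
    ultimately show ?case by blast
  qed
  then have "P (s X)" using X(1) by blast
  moreover have "s X = z"
    using z X(3) unfolding s_def by (intro extensionalityI[of _ "fin_supp I"]) auto
  ultimately show ?thesis by simp
qed

lemma cont_bihom_canon: "cont_bihom (ZI I) TT (dual (HI I)) (canon_bihom I)"
  unfolding cont_bihom_def
proof (intro conjI ballI allI impI)
  fix x assume "x \<in> tg_carrier (ZI I)"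
  then have x: "x \<in> (\<Pi>\<^sub>E i\<in>I. UNIV)" by simp
  show "cont_hom TT (dual (HI I)) (canon_bihom I x)"
    unfolding cont_hom_def
  proof (intro conjI ballI)
    show "canon_bihom I x t \<in> tg_carrier (dual (HI I))" for t by (rule canon_bihom_mem[OF x])
    show "canon_bihom I x (tg_add TT s t) = tg_add (dual (HI I)) (canon_bihom I x s) (canon_bihom I x t)" for s t
      unfolding canon_bihom_def dual_sel HI_sel TT_sel
    proof (rule restrict_ext)
      fix g assume g: "g \<in> fin_supp I"
      have "frac (s + t) * of_int (pairing g x) - (s + t) * of_int (pairing g x)
          = (frac (s + t) - (s + t)) * of_int (pairing g x)" by (simp add: left_diff_distrib)
      also have "\<dots> \<in> \<int>" by (intro Ints_mult frac_diff_Ints Ints_of_int)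
      finally have "frac (frac (s + t) * of_int (pairing g x)) = frac ((s + t) * of_int (pairing g x))"
        unfolding frac_eq_iff .
      then show "frac (frac (s + t) * of_int (pairing g x))
        = frac ((\<lambda>g\<in>fin_supp I. frac (s * of_int (pairing g x))) g + (\<lambda>g\<in>fin_supp I. frac (t * of_int (pairing g x))) g)"
        using g by (simp add: distrib_right)
    qed
    show "continuous_map (tg_top TT) (tg_top (dual (HI I))) (canon_bihom I x)"
    proof (rule continuous_map_into_dual_HI)
      fix g assume "g \<in> fin_supp I"
      then show "continuous_map (tg_top TT) (tg_top TT) (\<lambda>t. canon_bihom I x t g)"
        using continuous_map_TT_int_mult[OF continuous_map_id[of "tg_top TT", unfolded id_def], of "pairing g x"]
        by (simp add: canon_bihom_def mult.commute)
    qed (use canon_bihom_mem[OF x] in blast)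
  qed
next
  fix t assume "t \<in> tg_carrier TT"
  show "cont_hom (ZI I) (dual (HI I)) (\<lambda>x. canon_bihom I x t)"
    unfolding cont_hom_def
  proof (intro conjI ballI)
    show mem: "canon_bihom I x t \<in> tg_carrier (dual (HI I))" if "x \<in> tg_carrier (ZI I)" for x
      using that by (intro canon_bihom_mem) simp
    show "canon_bihom I (tg_add (ZI I) x y) t = tg_add (dual (HI I)) (canon_bihom I x t) (canon_bihom I y t)" for x y
      unfolding canon_bihom_def dual_sel HI_sel ZI_sel
      by (rule restrict_ext) (simp add: pairing_add_right distrib_left)
    show "continuous_map (tg_top (ZI I)) (tg_top (dual (HI I))) (\<lambda>x. canon_bihom I x t)"
    proof (rule continuous_map_into_dual_HI)
      fix g assume "g \<in> fin_supp I"
      then show "continuous_map (tg_top (ZI I)) (tg_top TT) (\<lambda>x. canon_bihom I x t g)"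
        using continuous_map_TT_mult_int[OF continuous_map_ZI_pairing[of g I], of t]
        by (simp add: canon_bihom_def del: ZI_sel)
    qed (use mem tag_topspace[OF top_ab_group_ZI[of I]] in \<open>auto simp del: ZI_sel\<close>)
  qed
next
  fix W assume "openin (tg_top (dual (HI I))) W \<and> tg_zero (dual (HI I)) \<in> W"
  then have W: "openin (tg_top (dual (HI I))) W" "tg_zero (dual (HI I)) \<in> W" by simp_all
  obtain S e where S: "finite S" "S \<subseteq> fin_supp I" "e > 0"
      "{w \<in> tg_carrier (dual (HI I)). \<forall>g\<in>S. tnorm (w g - tg_zero (dual (HI I)) g) < e} \<subseteq> W"
    using openin_dual_HI_near[OF W] by (elim exE conjE)
  define F where "F = (\<Union>g\<in>S. {i. g i \<noteq> 0})"
  have F: "finite F" "F \<subseteq> I" using S(1,2) by (auto simp: F_def fin_supp_def)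
  define U where "U = {x \<in> (\<Pi>\<^sub>E i\<in>I. UNIV). \<forall>i\<in>F. x i = (0::int)}"
  show "\<exists>U V. openin (tg_top (ZI I)) U \<and> tg_zero (ZI I) \<in> U \<and> openin (tg_top TT) V \<and> tg_zero TT \<in> V \<and>
      (\<forall>x\<in>U. \<forall>y\<in>V. canon_bihom I x y \<in> W)"
  proof (intro exI conjI ballI)
    show "openin (tg_top (ZI I)) U" unfolding U_def by (rule openin_ZI_vanishing[OF F])
    show "tg_zero (ZI I) \<in> U" using F by (auto simp: U_def)
    \<comment> \<open>When \<open>x\<close> vanishes on all supports occurring in \<open>S\<close>,
      the pairings are zero for every \<open>t\<close>, so no restriction on the circle variable is
      required.\<close>
    show "openin (tg_top TT) (topspace (tg_top TT))" by simp
    show "tg_zero TT \<in> topspace (tg_top TT)" by (simp add: top_TT)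
    fix x and y :: real assume x: "x \<in> U"
    have "pairing g x = 0" if "g \<in> S" for g
      unfolding pairing_def using x that by (intro sum.neutral) (auto simp: U_def F_def)
    then have "\<forall>g\<in>S. tnorm (canon_bihom I x y g - tg_zero (dual (HI I)) g) < e"
      using S(2,3) by (auto simp: canon_bihom_def)
    moreover have "canon_bihom I x y \<in> tg_carrier (dual (HI I))"
      using x by (intro canon_bihom_mem) (simp add: U_def)
    ultimately show "canon_bihom I x y \<in> W" using S(4) by blast
  qed
qed

section \<open>Factorization of bihomomorphisms\<close>

lemma tag_simps:
  assumes "top_ab_group G"
  shows "tg_zero G \<in> tg_carrier G"
    "x \<in> tg_carrier G \<Longrightarrow> y \<in> tg_carrier G \<Longrightarrow> tg_add G x y \<in> tg_carrier G"
    "x \<in> tg_carrier G \<Longrightarrow> tg_neg G x \<in> tg_carrier G"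
    "x \<in> tg_carrier G \<Longrightarrow> tg_add G x (tg_zero G) = x"
    "x \<in> tg_carrier G \<Longrightarrow> tg_add G x (tg_neg G x) = tg_zero G"
  using assms unfolding top_ab_group_def by blast+

lemma tag_assoc:
  assumes "top_ab_group G" "x \<in> tg_carrier G" "y \<in> tg_carrier G" "z \<in> tg_carrier G"
  shows "tg_add G (tg_add G x y) z = tg_add G x (tg_add G y z)"
  using assms unfolding top_ab_group_def by blast

lemma tag_comm:
  assumes "top_ab_group G" "x \<in> tg_carrier G" "y \<in> tg_carrier G"
  shows "tg_add G x y = tg_add G y x"
  using assms unfolding top_ab_group_def by blast

lemma tag_add_diff:
  assumes G: "top_ab_group G" and x: "x \<in> tg_carrier G" and y: "y \<in> tg_carrier G"
  shows "tg_add G x (tg_add G y (tg_neg G x)) = y"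
proof -
  have nx: "tg_neg G x \<in> tg_carrier G" using tag_simps(3)[OF G x] .
  have "tg_add G x (tg_add G y (tg_neg G x)) = tg_add G (tg_add G y (tg_neg G x)) x"
    by (rule tag_comm[OF G x tag_simps(2)[OF G y nx]])
  also have "\<dots> = tg_add G y (tg_add G (tg_neg G x) x)" by (rule tag_assoc[OF G y nx x])
  also have "tg_add G (tg_neg G x) x = tg_zero G"
    using tag_comm[OF G nx x] tag_simps(5)[OF G x] by (simp only:)
  also have "tg_add G y (tg_zero G) = y" by (rule tag_simps(4)[OF G y])
  finally show ?thesis .
qed

lemma tag_cancel:
  assumes G: "top_ab_group G" and x: "x \<in> tg_carrier G" and y: "y \<in> tg_carrier G"
    and "tg_add G y (tg_neg G x) = tg_zero G"
  shows "x = y"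
  using tag_add_diff[OF G x y] tag_simps(4)[OF G x] assms(4) by (simp only:)

lemma continuous_map_translation:
  assumes G: "top_ab_group G" and a: "a \<in> tg_carrier G"
  shows "continuous_map (tg_top G) (tg_top G) (\<lambda>x. tg_add G x a)"
proof -
  have "continuous_map (tg_top G) (prod_topology (tg_top G) (tg_top G)) (\<lambda>x. (x, a))"
    using a tag_topspace[OF G] by (intro continuous_map_pairedI) (simp_all add: continuous_map_id[unfolded id_def])
  moreover have "continuous_map (prod_topology (tg_top G) (tg_top G)) (tg_top G) (\<lambda>(x, y). tg_add G x y)"
    using G unfolding top_ab_group_def by blast
  ultimately have "continuous_map (tg_top G) (tg_top G) ((\<lambda>(x, y). tg_add G x y) \<circ> (\<lambda>x. (x, a)))"
    by (rule continuous_map_compose)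
  then show ?thesis by (simp add: o_def)
qed

text \<open>Translations are continuous and a homomorphism respects them, so continuity spreads from
  zero. Quasi-convex bases describe neighbourhoods of zero only.\<close>

lemma cont_hom_if_continuous_at_zero:
  assumes G: "top_ab_group G" and L: "top_ab_group L"
    and mem: "\<And>x. x \<in> tg_carrier G \<Longrightarrow> f x \<in> tg_carrier L"
    and add: "\<And>x y. x \<in> tg_carrier G \<Longrightarrow> y \<in> tg_carrier G \<Longrightarrow> f (tg_add G x y) = tg_add L (f x) (f y)"
    and zero: "\<And>W. openin (tg_top L) W \<Longrightarrow> tg_zero L \<in> W \<Longrightarrow>
      \<exists>N. openin (tg_top G) N \<and> tg_zero G \<in> N \<and> f ` N \<subseteq> W"
  shows "cont_hom G L f"
  unfolding cont_hom_def
proof (intro conjI ballI)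
  show "continuous_map (tg_top G) (tg_top L) f"
    unfolding continuous_map_def
  proof (intro conjI allI impI)
    show "f \<in> topspace (tg_top G) \<rightarrow> topspace (tg_top L)"
      unfolding tag_topspace[OF G] tag_topspace[OF L] using mem by (rule Pi_I)
    fix W assume W: "openin (tg_top L) W"
    show "openin (tg_top G) {x \<in> topspace (tg_top G). f x \<in> W}"
    proof (subst openin_subopen, intro ballI)
      fix x assume "x \<in> {x \<in> topspace (tg_top G). f x \<in> W}"
      then have x: "x \<in> tg_carrier G" "f x \<in> W" using tag_topspace[OF G] by simp_all
      have fx: "f x \<in> tg_carrier L" by (rule mem[OF x(1)])
      have oW: "openin (tg_top L) {l \<in> topspace (tg_top L). tg_add L l (f x) \<in> W}"
        by (rule openin_continuous_map_preimage[OF continuous_map_translation[OF L fx] W])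
      have zW: "tg_zero L \<in> {l \<in> topspace (tg_top L). tg_add L l (f x) \<in> W}"
        using tag_simps(1)[OF L] tag_comm[OF L tag_simps(1)[OF L] fx] tag_simps(4)[OF L fx] x(2) tag_topspace[OF L]
        by simp
      obtain N where N: "openin (tg_top G) N" "tg_zero G \<in> N"
          "f ` N \<subseteq> {l \<in> topspace (tg_top L). tg_add L l (f x) \<in> W}"
        using zero[OF oW zW] by (elim exE conjE)
      have nx: "tg_neg G x \<in> tg_carrier G" by (rule tag_simps(3)[OF G x(1)])
      define M where "M = {y \<in> topspace (tg_top G). tg_add G y (tg_neg G x) \<in> N}"
      have "openin (tg_top G) M"
        unfolding M_def by (rule openin_continuous_map_preimage[OF continuous_map_translation[OF G nx] N(1)])
      moreover have "x \<in> M"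
        using x(1) N(2) tag_simps(5)[OF G x(1)] tag_topspace[OF G] by (simp add: M_def)
      moreover have "M \<subseteq> {x \<in> topspace (tg_top G). f x \<in> W}"
      proof
        fix y assume y: "y \<in> M"
        then have yG: "y \<in> tg_carrier G" using tag_topspace[OF G] by (simp add: M_def)
        have dG: "tg_add G y (tg_neg G x) \<in> tg_carrier G" by (rule tag_simps(2)[OF G yG nx])
        have "f (tg_add G y (tg_neg G x)) \<in> {l \<in> topspace (tg_top L). tg_add L l (f x) \<in> W}"
          using y N(3) by (auto simp: M_def)
        then have "tg_add L (f (tg_add G y (tg_neg G x))) (f x) \<in> W" by simp
        moreover have "tg_add L (f (tg_add G y (tg_neg G x))) (f x) = f y"
          using add[OF dG x(1)] tag_comm[OF G dG x(1)] tag_add_diff[OF G x(1) yG] by (simp only:)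
        ultimately show "y \<in> {x \<in> topspace (tg_top G). f x \<in> W}" using yG tag_topspace[OF G] by simp
      qed
      ultimately show "\<exists>T. openin (tg_top G) T \<and> x \<in> T \<and> T \<subseteq> {x \<in> topspace (tg_top G). f x \<in> W}"
        by (intro exI[of _ M] conjI)
    qed
  qed
qed (simp_all only: mem add)

lemma cont_hom_compose:
  assumes "cont_hom G L f" "cont_hom L M h"
  shows "cont_hom G M (\<lambda>x. h (f x))"
  using assms continuous_map_compose[of "tg_top G" "tg_top L" f "tg_top M" h]
  unfolding cont_hom_def o_def by simp

section \<open>Separation of points and bounds for coefficients\<close>

text \<open>By the Hausdorff property some quasi-convex neighbourhood of zero misses the difference
  \<open>m\<close>; the character excluding \<open>m\<close> exceeds 1/4 there, so it is nonzero on
  the difference.\<close>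

lemma in_Q_separating_character:
  assumes L: "in_Q L" and l: "l \<in> tg_carrier L" "l' \<in> tg_carrier L" and ne: "l \<noteq> l'"
  shows "\<exists>ch. character L ch \<and> ch l \<noteq> ch l'"
proof -
  have G: "top_ab_group L" and H: "Hausdorff_space (tg_top L)" using L by (simp_all add: in_Q_def)
  define m where "m = tg_add L l' (tg_neg L l)"
  have m: "m \<in> tg_carrier L"
    unfolding m_def by (rule tag_simps(2)[OF G l(2) tag_simps(3)[OF G l(1)]])
  have "m \<noteq> tg_zero L" using tag_cancel[OF G l] ne unfolding m_def by blast
  then obtain U U' where U: "openin (tg_top L) U" "openin (tg_top L) U'" "tg_zero L \<in> U" "m \<in> U'" "disjnt U U'"
    using H m tag_simps(1)[OF G] tag_topspace[OF G] unfolding Hausdorff_space_def by metis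
  have "m \<notin> U" using U(4,5) by (auto simp: disjnt_iff)
  have "\<exists>V W. quasi_convex L V \<and> openin (tg_top L) W \<and> tg_zero L \<in> W \<and> W \<subseteq> V \<and> V \<subseteq> U"
    using L U(1,3) unfolding in_Q_def by blast
  then obtain V where V: "quasi_convex L V" "V \<subseteq> U" by blast
  then have "m \<in> tg_carrier L - V" using m \<open>m \<notin> U\<close> by blast
  then obtain ch where ch: "character L ch" "tnorm (ch m) > 1/4"
    using V(1) unfolding quasi_convex_def by blast
  have "ch l \<noteq> ch l'"
  proof
    assume eq: "ch l = ch l'"
    have "tg_add L l m = l'" unfolding m_def by (rule tag_add_diff[OF G l])
    then have "ch l' - (ch l + ch m) \<in> \<int>" using character_add_Ints[OF ch(1) l(1) m] by simp
    then have "ch m \<in> \<int>" using eq minus_in_Ints_iff[of "ch m"] by simp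
    then show False using ch(2) tnorm_eq_0[of "ch m"] by simp
  qed
  then show ?thesis using ch(1) by blast
qed

text \<open>Residues for all \<open>t\<close> determine the integer pairings, and unit vectors read
  off the coordinates. Hence a character of L has only one coefficient vector.\<close>

lemma fin_supp_eqI:
  assumes "g \<in> fin_supp I" "h \<in> fin_supp I"
    and "\<And>x t. x \<in> (\<Pi>\<^sub>E i\<in>I. UNIV) \<Longrightarrow> t \<in> {0..<1::real} \<Longrightarrow>
      frac (t * of_int (pairing g x)) = frac (t * of_int (pairing h x))"
  shows "g = h"
proof
  fix i
  show "g i = h i"
  proof (cases "i \<in> I")
    case True
    let ?e = "unit_vec I i"
    have "pairing g ?e - pairing h ?e = 0"
    proof (rule int_mult_Ints_imp_zero[of 1])
      fix t :: real assume "0 \<le> t" "t < 1"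
      then have "frac (t * of_int (pairing g ?e)) = frac (t * of_int (pairing h ?e))"
        by (intro assms(3) unit_vec_mem) simp
      then show "of_int (pairing g ?e - pairing h ?e) * t \<in> \<int>"
        by (simp add: frac_eq_iff algebra_simps)
    qed simp
    then show ?thesis using pairing_unit_vec[OF assms(1) True] pairing_unit_vec[OF assms(2) True] by simp
  next
    case False
    then show ?thesis using assms(1,2) by (simp add: fin_supp_def)
  qed
qed

lemma int_bounded_if_tnorm_small:
  fixes d :: real
  assumes "d > 0" and "\<And>t. 0 \<le> t \<Longrightarrow> t < d \<Longrightarrow> t < 1 \<Longrightarrow> tnorm (t * of_int k) \<le> 1/4"
  shows "\<bar>k\<bar> \<le> \<lceil>1 / (2 * d)\<rceil>"
proof (rule ccontr)
  assume "\<not> \<bar>k\<bar> \<le> \<lceil>1 / (2 * d)\<rceil>"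
  then have k: "1 / (2 * d) < \<bar>of_int k\<bar>" using less_ceiling_iff by linarith
  have "0 < 1 / (2 * d)" using assms(1) by simp
  then have "0 < \<bar>real_of_int k\<bar>" using k by (rule less_trans)
  then have k1: "\<bar>real_of_int k\<bar> \<ge> 1" by simp
  \<comment> \<open>Too large a \<open>k\<close> puts this \<open>t\<close> below \<open>d\<close>,
    although \<open>t * k\<close> is then plus or minus 1/2.\<close>
  define t where "t = 1 / (2 * \<bar>real_of_int k\<bar>)"
  have "t < d" using k assms(1) k1 by (simp add: t_def field_simps)
  moreover have "0 \<le> t" "t < 1" using k1 by (simp_all add: t_def field_simps)
  ultimately have "tnorm (t * of_int k) \<le> 1/4" by (intro assms(2))
  moreover have "\<bar>t * of_int k\<bar> = 1/2" using k1 by (simp add: t_def abs_mult)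
  then have "tnorm (t * of_int k) = 1/2" using tnorm_eq_abs[of "t * of_int k"] by simp
  ultimately show False by simp
qed

section \<open>The factorization of a fixed bihomomorphism\<close>

context
  fixes I :: "'a set" and L :: "'l tgroup" and c
  assumes L: "in_Q L" and c: "cont_bihom (ZI I) TT L c"
begin

private lemma L_group: "top_ab_group L"
  using L by (simp add: in_Q_def)

private lemma c_cont_hom_right: "x \<in> (\<Pi>\<^sub>E i\<in>I. UNIV) \<Longrightarrow> cont_hom TT L (c x)"
  using c by (simp add: cont_bihom_def)

private lemma c_mem: "x \<in> (\<Pi>\<^sub>E i\<in>I. UNIV) \<Longrightarrow> t \<in> {0..<1} \<Longrightarrow> c x t \<in> tg_carrier L"
  using c_cont_hom_right[of x] by (simp add: cont_hom_def)

private lemma c_add_left: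
  assumes "x \<in> (\<Pi>\<^sub>E i\<in>I. UNIV)" "y \<in> (\<Pi>\<^sub>E i\<in>I. UNIV)" "t \<in> {0..<1}"
  shows "c (\<lambda>i\<in>I. x i + y i) t = tg_add L (c x t) (c y t)"
proof -
  have "cont_hom (ZI I) L (\<lambda>x. c x t)" using c assms(3) unfolding cont_bihom_def TT_sel by blast
  then show ?thesis using assms(1,2) unfolding cont_hom_def ZI_sel by blast
qed

private lemma c_small:
  assumes "openin (tg_top L) W" "tg_zero L \<in> W"
  shows "\<exists>F d. finite F \<and> F \<subseteq> I \<and> d > 0 \<and>
    (\<forall>x\<in>(\<Pi>\<^sub>E i\<in>I. UNIV). \<forall>t. (\<forall>i\<in>F. x i = 0) \<longrightarrow> 0 \<le> t \<longrightarrow> t < d \<longrightarrow> t < 1 \<longrightarrow> c x t \<in> W)"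
proof -
  have "\<exists>U V. openin (tg_top (ZI I)) U \<and> tg_zero (ZI I) \<in> U \<and> openin (tg_top TT) V \<and> tg_zero TT \<in> V \<and>
      (\<forall>x\<in>U. \<forall>y\<in>V. c x y \<in> W)"
    using c assms unfolding cont_bihom_def by blast
  then obtain U V where UV: "openin (tg_top (ZI I)) U" "tg_zero (ZI I) \<in> U" "openin (tg_top TT) V" "tg_zero TT \<in> V"
      "\<forall>x\<in>U. \<forall>y\<in>V. c x y \<in> W" by (elim exE conjE)
  obtain F where F: "finite F" "F \<subseteq> I" "{x \<in> (\<Pi>\<^sub>E i\<in>I. UNIV). \<forall>i\<in>F. x i = 0} \<subseteq> U"
    using ZI_nbhd_zero[OF UV(1,2)] by (elim exE conjE)
  obtain d where d: "d > 0" "circle.mball 0 d \<subseteq> V"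
    using UV(3,4) unfolding top_TT circle.openin_mtopology TT_sel by blast
  have "c x t \<in> W" if "x \<in> (\<Pi>\<^sub>E i\<in>I. UNIV)" "\<forall>i\<in>F. x i = 0" "0 \<le> t" "t < d" "t < 1" for x t
  proof -
    have "x \<in> U" using that(1,2) F(3) by blast
    moreover have "t \<in> circle.mball 0 d" using that(3-5) tnorm_le_abs[of t] by simp
    ultimately show ?thesis using d(2) UV(5) by blast
  qed
  then show ?thesis using F(1,2) d(1) by blast
qed

text \<open>\<open>F\<close> and \<open>d\<close> are parameters and are not derived from
  \<open>ch\<close>, so that one choice serves every character in the polar of a
  neighbourhood.\<close>

private lemma character_c_eq_pairing:
  assumes ch: "character L ch" and F: "finite F" "F \<subseteq> I" and d: "d > 0"
    and small: "\<And>x t. x \<in> (\<Pi>\<^sub>E i\<in>I. UNIV) \<Longrightarrow> (\<And>i. i \<in> F \<Longrightarrow> x i = 0) \<Longrightarrow> 0 \<le> t \<Longrightarrow> t < d \<Longrightarrow> t < 1 \<Longrightarrow>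
      tnorm (ch (c x t)) \<le> 1/4"
  shows "\<exists>g\<in>fin_supp I. (\<forall>i. i \<notin> F \<longrightarrow> g i = 0) \<and>
    (\<forall>x\<in>(\<Pi>\<^sub>E i\<in>I. UNIV). \<forall>t\<in>{0..<1}. ch (c x t) = frac (t * of_int (pairing g x)))"
proof (rule ZI_TT_bihom_eq_pairing[where b = "\<lambda>x t. ch (c x t)", OF _ _ F d])
  fix x :: "'a \<Rightarrow> int" assume "x \<in> (\<Pi>\<^sub>E i\<in>I. UNIV)"
  then show "character TT (\<lambda>t. ch (c x t))"
    using cont_hom_compose[OF c_cont_hom_right] ch unfolding character_def by blast
next
  fix x y :: "'a \<Rightarrow> int" and t :: real
  assume "x \<in> (\<Pi>\<^sub>E i\<in>I. UNIV)" "y \<in> (\<Pi>\<^sub>E i\<in>I. UNIV)" "t \<in> {0..<1}"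
  then show "ch (c (\<lambda>i\<in>I. x i + y i) t) = frac (ch (c x t) + ch (c y t))"
    using character_add[OF ch] c_add_left c_mem by (simp only:)
qed (rule small)

private lemma character_c_ex:
  assumes ch: "character L ch"
  shows "\<exists>g\<in>fin_supp I. \<forall>x\<in>(\<Pi>\<^sub>E i\<in>I. UNIV). \<forall>t\<in>{0..<1}. ch (c x t) = frac (t * of_int (pairing g x))"
proof -
  define W where "W = {l \<in> topspace (tg_top L). tnorm (ch l - 0) < 1/4}"
  have oW: "openin (tg_top L) W"
    unfolding W_def by (intro openin_TT_preimage_ball character_cont ch) simp
  have zW: "tg_zero L \<in> W"
    using character_zero[OF L_group ch] tag_simps(1)[OF L_group] tag_topspace[OF L_group] by (simp add: W_def)
  obtain F d where F: "finite F" "F \<subseteq> I" "d > 0"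
      "\<forall>x\<in>(\<Pi>\<^sub>E i\<in>I. UNIV). \<forall>t. (\<forall>i\<in>F. x i = 0) \<longrightarrow> 0 \<le> t \<longrightarrow> t < d \<longrightarrow> t < 1 \<longrightarrow> c x t \<in> W"
    using c_small[OF oW zW] by (elim exE conjE)
  have "tnorm (ch (c x t)) \<le> 1/4"
    if "x \<in> (\<Pi>\<^sub>E i\<in>I. UNIV)" "\<And>i. i \<in> F \<Longrightarrow> x i = 0" "0 \<le> t" "t < d" "t < 1" for x t
  proof -
    have "c x t \<in> W" using F(4) that by blast
    then show ?thesis by (simp add: W_def)
  qed
  then show ?thesis using character_c_eq_pairing[OF ch F(1-3)] by blast
qed

text \<open>For a character of L the choice is from a single vector, by \<open>fin_supp_eqI\<close>;
  for other functions the value is of no concern.\<close>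

private definition coeff_vec :: "('l \<Rightarrow> real) \<Rightarrow> 'a \<Rightarrow> int" where
  "coeff_vec ch = (SOME g. g \<in> fin_supp I \<and>
    (\<forall>x\<in>(\<Pi>\<^sub>E i\<in>I. UNIV). \<forall>t\<in>{0..<1}. ch (c x t) = frac (t * of_int (pairing g x))))"

private lemma coeff_vec:
  assumes "character L ch"
  shows "coeff_vec ch \<in> fin_supp I"
    and "x \<in> (\<Pi>\<^sub>E i\<in>I. UNIV) \<Longrightarrow> t \<in> {0..<1} \<Longrightarrow> ch (c x t) = frac (t * of_int (pairing (coeff_vec ch) x))"
proof -
  have "\<exists>g. g \<in> fin_supp I \<and>
    (\<forall>x\<in>(\<Pi>\<^sub>E i\<in>I. UNIV). \<forall>t\<in>{0..<1}. ch (c x t) = frac (t * of_int (pairing g x)))"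
    using character_c_ex[OF assms] by blast
  from someI_ex[OF this, folded coeff_vec_def]
  show "coeff_vec ch \<in> fin_supp I"
    and "x \<in> (\<Pi>\<^sub>E i\<in>I. UNIV) \<Longrightarrow> t \<in> {0..<1} \<Longrightarrow> ch (c x t) = frac (t * of_int (pairing (coeff_vec ch) x))"
    by blast+
qed

text \<open>Joint continuity at the origin provides the common support \<open>F\<close>. It gives no
  bound on coordinates inside \<open>F\<close>, whose unit vectors do not vanish on
  \<open>F\<close>; there the bound comes from continuity of \<open>c (unit_vec I i)\<close> at
  zero, with a radius \<open>e i\<close> depending on \<open>W\<close> but not on the
  character.\<close>

private lemma finite_coeff_vec_polar:
  assumes W: "openin (tg_top L) W" "tg_zero L \<in> W"
  shows "\<exists>S. finite S \<and> S \<subseteq> fin_supp I \<and>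
    (\<forall>ch. character L ch \<longrightarrow> (\<forall>l\<in>W. tnorm (ch l) \<le> 1/4) \<longrightarrow> coeff_vec ch \<in> S)"
proof -
  obtain F d where F: "finite F" "F \<subseteq> I" "d > 0"
      "\<forall>x\<in>(\<Pi>\<^sub>E i\<in>I. UNIV). \<forall>t. (\<forall>i\<in>F. x i = 0) \<longrightarrow> 0 \<le> t \<longrightarrow> t < d \<longrightarrow> t < 1 \<longrightarrow> c x t \<in> W"
    using c_small[OF W] by (elim exE conjE)
  have "\<exists>e>0. \<forall>t. 0 \<le> t \<longrightarrow> t < e \<longrightarrow> t < 1 \<longrightarrow> c (unit_vec I i) t \<in> W" for i
  proof -
    have ch: "cont_hom TT L (c (unit_vec I i))" by (rule c_cont_hom_right[OF unit_vec_mem])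
    have "c (unit_vec I i) 0 = tg_zero L"
    proof -
      have z: "c (unit_vec I i) 0 \<in> tg_carrier L" by (rule c_mem[OF unit_vec_mem]) simp
      have "c (unit_vec I i) (tg_add TT 0 0) = tg_add L (c (unit_vec I i) 0) (c (unit_vec I i) 0)"
        using ch unfolding cont_hom_def TT_sel by (elim conjE) (drule bspec[where x = 0], simp_all)
      then have "tg_add L (c (unit_vec I i) 0) (c (unit_vec I i) 0) = c (unit_vec I i) 0" by simp
      then show ?thesis
        using tag_add_diff[OF L_group z z] tag_simps(5)[OF L_group z] tag_assoc[OF L_group z z tag_simps(3)[OF L_group z]]
          tag_simps(4)[OF L_group z] by simp
    qed
    moreover have "openin (tg_top TT) {t \<in> topspace (tg_top TT). c (unit_vec I i) t \<in> W}"
      using ch W(1) unfolding cont_hom_def by (intro openin_continuous_map_preimage) blast+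
    ultimately obtain e where e: "e > 0" "circle.mball 0 e \<subseteq> {t \<in> topspace (tg_top TT). c (unit_vec I i) t \<in> W}"
      using W(2) unfolding top_TT circle.openin_mtopology by auto
    have "c (unit_vec I i) t \<in> W" if "0 \<le> t" "t < e" "t < 1" for t
    proof -
      have "t \<in> circle.mball 0 e" using that tnorm_le_abs[of t] by simp
      then show ?thesis using e(2) by blast
    qed
    then show ?thesis using e(1) by blast
  qed
  then obtain e where e: "\<And>i. e i > 0" "\<And>i t. 0 \<le> t \<Longrightarrow> t < e i \<Longrightarrow> t < 1 \<Longrightarrow> c (unit_vec I i) t \<in> W"
    by metis
  \<comment> \<open>Absolute values make all summands nonnegative, so the sum dominates each
    individual bound.\<close>
  define N where "N = (\<Sum>i\<in>F. \<bar>\<lceil>1 / (2 * e i)\<rceil>\<bar>)"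
  define S where "S = {g. \<forall>i. (i \<in> F \<longrightarrow> g i \<in> {-N..N}) \<and> (i \<notin> F \<longrightarrow> g i = (0::int))}"
  have "coeff_vec ch \<in> S" if ch: "character L ch" and polar: "\<forall>l\<in>W. tnorm (ch l) \<le> 1/4" for ch
  proof -
    have "\<exists>g\<in>fin_supp I. (\<forall>i. i \<notin> F \<longrightarrow> g i = 0) \<and>
      (\<forall>x\<in>(\<Pi>\<^sub>E i\<in>I. UNIV). \<forall>t\<in>{0..<1}. ch (c x t) = frac (t * of_int (pairing g x)))"
      using polar F(4) by (intro character_c_eq_pairing[OF ch F(1-3)]) blast
    then obtain g where g: "g \<in> fin_supp I" "\<forall>i. i \<notin> F \<longrightarrow> g i = 0"
        "\<forall>x\<in>(\<Pi>\<^sub>E i\<in>I. UNIV). \<forall>t\<in>{0..<1}. ch (c x t) = frac (t * of_int (pairing g x))"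
      by (elim bexE conjE)
    have "coeff_vec ch = g"
      using coeff_vec(1)[OF ch] g(1) by (rule fin_supp_eqI) (use coeff_vec(2)[OF ch] g(3) in simp)
    moreover have "\<bar>g i\<bar> \<le> N" if i: "i \<in> F" for i
    proof -
      have "\<bar>g i\<bar> \<le> \<lceil>1 / (2 * e i)\<rceil>"
      proof (rule int_bounded_if_tnorm_small[OF e(1)])
        fix t assume t: "0 \<le> t" "t < e i" "t < 1"
        have "tnorm (ch (c (unit_vec I i) t)) \<le> 1/4" using polar e(2)[OF t] by blast
        moreover have "ch (c (unit_vec I i) t) = frac (t * of_int (pairing g (unit_vec I i)))"
          using bspec[OF bspec[OF g(3) unit_vec_mem[of I i]], of t] t by simp
        ultimately show "tnorm (t * of_int (g i)) \<le> 1/4"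
          using pairing_unit_vec[OF g(1), of i] i F(2) by auto
      qed
      also have "\<dots> \<le> \<bar>\<lceil>1 / (2 * e i)\<rceil>\<bar>" by (rule abs_ge_self)
      also have "\<dots> \<le> N" unfolding N_def using F(1) i by (intro member_le_sum) auto
      finally show ?thesis .
    qed
    ultimately show ?thesis using g(2) by (simp add: S_def abs_le_iff minus_le_iff)
  qed
  moreover have "finite S" unfolding S_def by (intro finite_set_of_finite_funs F(1)) simp
  moreover have "S \<subseteq> fin_supp I"
  proof
    fix g assume g: "g \<in> S"
    have "finite {i. g i \<noteq> 0}" by (rule finite_subset[OF _ F(1)]) (use g in \<open>auto simp: S_def\<close>)
    then show "g \<in> fin_supp I" using g F(2) by (auto simp: fin_supp_def S_def)
  qed
  ultimately show ?thesis by blast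
qed

text \<open>A relation that mentions no expression of \<open>z\<close> as a sum: it is compatible
  with addition and holds between canonical elements and values of \<open>c\<close>, so existence
  follows by generation and uniqueness by separation of points.\<close>

private definition represents :: "(('a \<Rightarrow> int) \<Rightarrow> real) \<Rightarrow> 'l \<Rightarrow> bool" where
  "represents z l \<longleftrightarrow> l \<in> tg_carrier L \<and> (\<forall>ch. character L ch \<longrightarrow> ch l = z (coeff_vec ch))"

private lemma represents_unique: "represents z l \<Longrightarrow> represents z l' \<Longrightarrow> l = l'"
  using in_Q_separating_character[OF L, of l l'] unfolding represents_def by metis

private lemma represents_canon:
  assumes "x \<in> (\<Pi>\<^sub>E i\<in>I. UNIV)" "t \<in> {0..<1}"
  shows "represents (canon_bihom I x t) (c x t)"
  unfolding represents_def canon_bihom_def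
  using c_mem[OF assms] coeff_vec(1) coeff_vec(2)[OF _ assms] by simp

private lemma represents_add:
  assumes "represents u l" "represents v l'"
  shows "represents (tg_add (dual (HI I)) u v) (tg_add L l l')"
  unfolding represents_def
proof (intro conjI allI impI)
  have l: "l \<in> tg_carrier L" "l' \<in> tg_carrier L" using assms by (simp_all add: represents_def)
  then show "tg_add L l l' \<in> tg_carrier L" by (rule tag_simps(2)[OF L_group])
  fix ch assume ch: "character L ch"
  have "ch l = u (coeff_vec ch)" "ch l' = v (coeff_vec ch)" using assms ch by (simp_all add: represents_def)
  then show "ch (tg_add L l l') = tg_add (dual (HI I)) u v (coeff_vec ch)"
    using character_add[OF ch l] coeff_vec(1)[OF ch] by simp
qed

private lemma represents_ex: "z \<in> tg_carrier (dual (HI I)) \<Longrightarrow> \<exists>l. represents z l"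
proof (induction rule: dual_HI_induct)
  case (canon x t)
  then show ?case using represents_canon by blast
next
  case (add u v)
  then show ?case using represents_add by blast
qed

lemma factor_through_canon_bihom:
  "\<exists>\<phi>. cont_hom (dual (HI I)) L \<phi> \<and>
    (\<forall>x\<in>(\<Pi>\<^sub>E i\<in>I. UNIV). \<forall>t\<in>{0..<1}. c x t = \<phi> (canon_bihom I x t))"
proof -
  define \<phi> where "\<phi> z = (SOME l. represents z l)" for z
  have rep: "represents z (\<phi> z)" if "z \<in> tg_carrier (dual (HI I))" for z
    unfolding \<phi>_def by (rule someI_ex[OF represents_ex[OF that]])
  have eq: "\<phi> z = l" if "z \<in> tg_carrier (dual (HI I))" "represents z l" for z l
    using represents_unique[OF rep[OF that(1)] that(2)] .
  note D = top_ab_group_dual_HI[of I]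
  have "cont_hom (dual (HI I)) L \<phi>"
  proof (rule cont_hom_if_continuous_at_zero[OF D L_group])
    fix z assume "z \<in> tg_carrier (dual (HI I))"
    then show "\<phi> z \<in> tg_carrier L" using rep by (simp add: represents_def)
  next
    fix z w assume zw: "z \<in> tg_carrier (dual (HI I))" "w \<in> tg_carrier (dual (HI I))"
    show "\<phi> (tg_add (dual (HI I)) z w) = tg_add L (\<phi> z) (\<phi> w)"
      by (rule eq[OF tag_simps(2)[OF D zw] represents_add[OF rep[OF zw(1)] rep[OF zw(2)]]])
  next
    fix U assume U: "openin (tg_top L) U" "tg_zero L \<in> U"
    have "\<exists>V W. quasi_convex L V \<and> openin (tg_top L) W \<and> tg_zero L \<in> W \<and> W \<subseteq> V \<and> V \<subseteq> U"
      using L U unfolding in_Q_def by blast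
    then obtain V W where V: "quasi_convex L V" "V \<subseteq> U" and W: "openin (tg_top L) W" "tg_zero L \<in> W" "W \<subseteq> V"
      by (elim exE conjE)
    obtain S where S: "finite S" "S \<subseteq> fin_supp I"
        "\<forall>ch. character L ch \<longrightarrow> (\<forall>l\<in>W. tnorm (ch l) \<le> 1/4) \<longrightarrow> coeff_vec ch \<in> S"
      using finite_coeff_vec_polar[OF W(1,2)] by (elim exE conjE)
    \<comment> \<open>Only the finitely many evaluations at \<open>S\<close> are constrained, so
      this set is open for pointwise convergence.\<close>
    define N where "N = (\<Inter>g\<in>S. {z \<in> topspace (tg_top (dual (HI I))). tnorm (z g - 0) < 1/4})
      \<inter> topspace (tg_top (dual (HI I)))"
    have "openin (tg_top (dual (HI I))) N"
      unfolding N_def using S(2)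
      by (intro openin_INT S(1) openin_TT_preimage_ball character_cont character_dual_HI_eval) auto
    moreover have "tg_zero (dual (HI I)) \<in> N"
    proof -
      have "tnorm (tg_zero (dual (HI I)) g - 0) < 1/4" if "g \<in> S" for g
        using that S(2) by auto
      then show ?thesis using tag_simps(1)[OF D] unfolding N_def topspace_dual by blast
    qed
    moreover have "\<phi> ` N \<subseteq> U"
    proof (rule image_subsetI, rule ccontr)
      fix z assume z: "z \<in> N" and notU: "\<phi> z \<notin> U"
      have zD: "z \<in> tg_carrier (dual (HI I))" using z unfolding N_def topspace_dual by blast
      have r: "represents z (\<phi> z)" by (rule rep[OF zD])
      then have "\<phi> z \<in> tg_carrier L - V" using notU V(2) unfolding represents_def by blast
      \<comment> \<open>A character witnessing that \<phi> z is outside \<open>V\<close> is bounded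
        by 1/4 on \<open>W\<close>, so its coefficient vector belongs to \<open>S\<close>, where
        \<open>z\<close> is already small.\<close>
      then obtain ch where ch: "character L ch" "\<forall>a\<in>V. tnorm (ch a) \<le> 1/4" "tnorm (ch (\<phi> z)) > 1/4"
        using V(1) unfolding quasi_convex_def by blast
      have "coeff_vec ch \<in> S" using S(3) ch(1,2) W(3) by blast
      then have "tnorm (z (coeff_vec ch)) < 1/4" using z by (auto simp: N_def)
      moreover have "ch (\<phi> z) = z (coeff_vec ch)" using r ch(1) by (simp add: represents_def)
      ultimately show False using ch(3) by simp
    qed
    ultimately show "\<exists>N. openin (tg_top (dual (HI I))) N \<and> tg_zero (dual (HI I)) \<in> N \<and> \<phi> ` N \<subseteq> U"
      by (intro exI[of _ N] conjI)
  qed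
  moreover have "c x t = \<phi> (canon_bihom I x t)" if "x \<in> (\<Pi>\<^sub>E i\<in>I. UNIV)" "t \<in> {0..<1}" for x t
    by (rule sym, rule eq[OF canon_bihom_mem[OF that(1)] represents_canon[OF that]])
  ultimately show ?thesis by (intro exI[of _ \<phi>] conjI ballI)
qed

end

lemma cont_hom_dual_HI_unique:
  assumes "cont_hom (dual (HI I)) L \<phi>" "cont_hom (dual (HI I)) L \<psi>"
    and eq: "\<And>x t. x \<in> (\<Pi>\<^sub>E i\<in>I. UNIV) \<Longrightarrow> t \<in> {0..<1} \<Longrightarrow>
      \<psi> (canon_bihom I x t) = \<phi> (canon_bihom I x t)"
    and z: "z \<in> tg_carrier (dual (HI I))"
  shows "\<psi> z = \<phi> z"
  using z
proof (induction rule: dual_HI_induct)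
  case (canon x t)
  then show ?case by (rule eq)
next
  case (add u v)
  have "\<phi> (tg_add (dual (HI I)) u v) = tg_add L (\<phi> u) (\<phi> v)"
    "\<psi> (tg_add (dual (HI I)) u v) = tg_add L (\<psi> u) (\<psi> v)"
    using assms(1,2) add(1,2) unfolding cont_hom_def by blast+
  then show ?case using add(3,4) by (simp only:)
qed

theorem theorem4p15:
  fixes I :: "'a set"
  assumes "nonmeasurable_card I"
  shows "is_Q_tensor TYPE('l) (ZI I) TT (dual (HI I)) (canon_bihom I)"
  unfolding is_Q_tensor_def
proof (intro conjI allI impI in_Q_ZI in_Q_TT in_Q_dual_HI cont_bihom_canon)
  fix L :: "'l tgroup" and c
  assume "in_Q L \<and> cont_bihom (ZI I) TT L c"
  then have L: "in_Q L" "cont_bihom (ZI I) TT L c" by simp_all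
  obtain \<phi> where \<phi>: "cont_hom (dual (HI I)) L \<phi>"
      "\<forall>x\<in>(\<Pi>\<^sub>E i\<in>I. UNIV). \<forall>t\<in>{0..<1}. c x t = \<phi> (canon_bihom I x t)"
    using factor_through_canon_bihom[OF L] by (elim exE conjE)
  show "\<exists>\<phi>. cont_hom (dual (HI I)) L \<phi> \<and>
      (\<forall>x\<in>tg_carrier (ZI I). \<forall>y\<in>tg_carrier TT. c x y = \<phi> (canon_bihom I x y)) \<and>
      (\<forall>\<psi>. cont_hom (dual (HI I)) L \<psi> \<and>
        (\<forall>x\<in>tg_carrier (ZI I). \<forall>y\<in>tg_carrier TT. c x y = \<psi> (canon_bihom I x y)) \<longrightarrow>
        (\<forall>z\<in>tg_carrier (dual (HI I)). \<psi> z = \<phi> z))"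
  proof (intro exI conjI allI impI ballI)
    show "cont_hom (dual (HI I)) L \<phi>" by (rule \<phi>(1))
    show "c x y = \<phi> (canon_bihom I x y)" if "x \<in> tg_carrier (ZI I)" "y \<in> tg_carrier TT" for x y
      using that unfolding ZI_sel TT_sel by (rule bspec[OF bspec[OF \<phi>(2)]])
    fix \<psi> z
    assume \<psi>: "cont_hom (dual (HI I)) L \<psi> \<and>
        (\<forall>x\<in>tg_carrier (ZI I). \<forall>y\<in>tg_carrier TT. c x y = \<psi> (canon_bihom I x y))"
      and z: "z \<in> tg_carrier (dual (HI I))"
    show "\<psi> z = \<phi> z"
    proof (rule cont_hom_dual_HI_unique[OF \<phi>(1) _ _ z])
      show "cont_hom (dual (HI I)) L \<psi>" using \<psi> by (rule conjunct1)
      fix x :: "'a \<Rightarrow> int" and t :: real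
      assume xt: "x \<in> (\<Pi>\<^sub>E i\<in>I. UNIV)" "t \<in> {0..<1}"
      have "c x t = \<psi> (canon_bihom I x t)"
        by (rule bspec[OF bspec[OF conjunct2[OF \<psi>, unfolded ZI_sel TT_sel]]]) (fact xt)+
      moreover have "c x t = \<phi> (canon_bihom I x t)" by (rule bspec[OF bspec[OF \<phi>(2)]]) (fact xt)+
      ultimately show "\<psi> (canon_bihom I x t) = \<phi> (canon_bihom I x t)" by (simp only:)
    qed
  qed
qed

end
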